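(* Let $G$ be a group with a $\overline{C}$-type presentation $\Pi$ with generator set $\Gamma$. Then there is a sequence of surjective group homomorphisms $$G^{\mathcal{A}}\ \twoheadrightarrow\ G^{\mathcal{D}}\ \twoheadrightarrow\ G,\qquad a\mapsto e_a\mapsto a\quad (a\in\Gamma),$$ where: (1) the first map is the quotient map imposing that the element $a^k$ be central whenever $\Pi$ contains a relation $a^k=1$ (that is, its kernel is the normal closure of the commutators of such elements $a^k$ with the elements of $G^{\mathcal{A}}$); (2) the second map is the quotient map collapsing all these central elements to $1$ (that is, its kernel is generated by the central elements $e_a^k$, for the power relations $a^k=1$ of $\Pi$), and it presents $G^{\mathcal{D}}$ as a central extension $$0\to\mathbb{Z}^{\mathfrak{C}_{\mathrm{fg}}(G)}\to G^{\mathcal{D}}\to G\to 0,$$ where $\mathfrak{C}_{\mathrm{fg}}(G)$ is the set of all conjugacy classes of $G$ containing finite order generators (elements of $\Gamma$ of finite order in $G$).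
   Context: A $\overline{C}$-type presentation $\Pi$ of a group $G$, with generator set $\Gamma$, is a presentation in which every relation is either a conjugation relation $b^{-1}ab=c$ with $a,b,c\in\Gamma$, or a power relation $a^k=1$ with $a\in\Gamma$, $k\ge 2$; there is at most one power relation per conjugacy class of $G$ (i.e., for each conjugacy class $\mathcal{O}$ of $G$, at most one power relation $a^k=1$ has $a\in\mathcal{O}$). Generators are also regarded as elements of $G$. $G^{\mathcal{A}}$ (the Artin-type lift) is the group defined by keeping all the generators and only the conjugation relations of $\Pi$. The Dehn quandle $\Gamma^G$ is the union of the $G$-conjugacy classes of the elements of $\Gamma$ in $G$, with the operation $a\triangleleft b=b^{-1}ab$, and $G^{\mathcal{D}}:=\mathrm{As}(\Gamma^G)=\langle e_a,\ a\in\Gamma^G\mid e_ae_b=e_be_{a\triangleleft b},\ a,b\in\Gamma^G\rangle$. For a set $X$, $\mathbb{Z}^{X}$ denotes the free abelian group with basis $X$ (direct sum). *)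

theory Defs
  imports "HOL-Algebra.Algebra"
begin

section \<open>Groups given by generators and relations\<close>

text \<open>
  A letter \<open>(a, True)\<close> stands for the generator \<open>a\<close> and \<open>(a, False)\<close> for its formal inverse.
  A pair of words \<open>(u, v)\<close> stands for the relation \<open>u = v\<close>.
\<close>

type_synonym 'a word = "('a \<times> bool) list"

definition words :: "'a set \<Rightarrow> 'a word set"
  where "words S = lists (S \<times> UNIV)"

inductive_set word_cong :: "'a set \<Rightarrow> ('a word \<times> 'a word) set \<Rightarrow> ('a word \<times> 'a word) set"
  for S :: "'a set" and R :: "('a word \<times> 'a word) set" where
    refl: "u \<in> words S \<Longrightarrow> (u, u) \<in> word_cong S R"
  | sym: "(u, v) \<in> word_cong S R \<Longrightarrow> (v, u) \<in> word_cong S R"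
  | trans: "(u, v) \<in> word_cong S R \<Longrightarrow> (v, w) \<in> word_cong S R \<Longrightarrow> (u, w) \<in> word_cong S R"
  | append: "(u, v) \<in> word_cong S R \<Longrightarrow> (u', v') \<in> word_cong S R \<Longrightarrow> (u @ u', v @ v') \<in> word_cong S R"
  | cancel: "a \<in> S \<Longrightarrow> ([(a, s), (a, \<not> s)], []) \<in> word_cong S R"
  | relation: "(u, v) \<in> R \<Longrightarrow> u \<in> words S \<Longrightarrow> v \<in> words S \<Longrightarrow> (u, v) \<in> word_cong S R"

definition presented_group :: "'a set \<Rightarrow> ('a word \<times> 'a word) set \<Rightarrow> 'a word set monoid"
  where "presented_group S R =
    \<lparr>carrier = words S // word_cong S R,
     monoid.mult = (\<lambda>A B. \<Union>u\<in>A. \<Union>v\<in>B. word_cong S R `` {u @ v}),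
     one = word_cong S R `` {[]}\<rparr>"

definition presented_gen :: "'a set \<Rightarrow> ('a word \<times> 'a word) set \<Rightarrow> 'a \<Rightarrow> 'a word set"
  where "presented_gen S R a = word_cong S R `` {[(a, True)]}"

text \<open>
  The generators are abstract symbols; the map \<open>\<iota>\<close> sends each symbol to the element of \<open>G\<close> that it
  denotes.
\<close>

definition is_presentation ::
    "('g, 'm) monoid_scheme \<Rightarrow> 'a set \<Rightarrow> ('a word \<times> 'a word) set \<Rightarrow> ('a \<Rightarrow> 'g) \<Rightarrow> bool"
  where "is_presentation G S R \<iota> \<longleftrightarrow>
    group G \<and> (\<exists>\<phi> \<in> iso (presented_group S R) G. \<forall>a\<in>S. \<phi> (presented_gen S R a) = \<iota> a)"


section \<open>Conjugacy classes, centres, normal closures, central extensions\<close>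

definition conj_op :: "('g, 'm) monoid_scheme \<Rightarrow> 'g \<Rightarrow> 'g \<Rightarrow> 'g"
  where "conj_op G a b = inv\<^bsub>G\<^esub> b \<otimes>\<^bsub>G\<^esub> a \<otimes>\<^bsub>G\<^esub> b"

definition conj_class :: "('g, 'm) monoid_scheme \<Rightarrow> 'g \<Rightarrow> 'g set"
  where "conj_class G a = conj_op G a ` carrier G"

definition conj_classes :: "('g, 'm) monoid_scheme \<Rightarrow> 'g set set"
  where "conj_classes G = conj_class G ` carrier G"

definition group_center :: "('g, 'm) monoid_scheme \<Rightarrow> 'g set"
  where "group_center G = {z \<in> carrier G. \<forall>x\<in>carrier G. z \<otimes>\<^bsub>G\<^esub> x = x \<otimes>\<^bsub>G\<^esub> z}"

definition commutator :: "('g, 'm) monoid_scheme \<Rightarrow> 'g \<Rightarrow> 'g \<Rightarrow> 'g"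
  where "commutator G x y = inv\<^bsub>G\<^esub> x \<otimes>\<^bsub>G\<^esub> inv\<^bsub>G\<^esub> y \<otimes>\<^bsub>G\<^esub> x \<otimes>\<^bsub>G\<^esub> y"

definition normal_closure :: "('g, 'm) monoid_scheme \<Rightarrow> 'g set \<Rightarrow> 'g set"
  where "normal_closure G A = \<Inter> {N. N \<lhd> G \<and> A \<subseteq> N}"

definition central_extension ::
    "('n, 'k) monoid_scheme \<Rightarrow> ('n \<Rightarrow> 'e) \<Rightarrow> ('e, 'l) monoid_scheme \<Rightarrow> ('e \<Rightarrow> 'g)
      \<Rightarrow> ('g, 'm) monoid_scheme \<Rightarrow> bool"
  where "central_extension N i E p G \<longleftrightarrow>
    group N \<and> group E \<and> group G \<and> i \<in> mon N E \<and> p \<in> epi E G \<and>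
    i ` carrier N = kernel E G p \<and> i ` carrier N \<subseteq> group_center E"


section \<open>Presentations by conjugation and power relations\<close>

definition conj_rel :: "'a \<Rightarrow> 'a \<Rightarrow> 'a \<Rightarrow> 'a word \<times> 'a word"
  where "conj_rel a b c = ([(b, False), (a, True), (b, True)], [(c, True)])"

definition power_rel :: "'a \<Rightarrow> nat \<Rightarrow> 'a word \<times> 'a word"
  where "power_rel a k = (replicate k (a, True), [])"

definition Cbar_presentation ::
    "('g, 'm) monoid_scheme \<Rightarrow> 'a set \<Rightarrow> ('a word \<times> 'a word) set \<Rightarrow> ('a \<Rightarrow> 'g) \<Rightarrow> bool"
  where "Cbar_presentation G \<Gamma> R \<iota> \<longleftrightarrow>
    is_presentation G \<Gamma> R \<iota> \<and>
    (\<forall>r\<in>R. (\<exists>a\<in>\<Gamma>. \<exists>b\<in>\<Gamma>. \<exists>c\<in>\<Gamma>. r = conj_rel a b c) \<or>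
            (\<exists>a\<in>\<Gamma>. \<exists>k\<ge>2. r = power_rel a k)) \<and>
    (\<forall>K\<in>conj_classes G. \<exists>\<^sub>\<le>\<^sub>1 r. r \<in> R \<and> (\<exists>a\<in>\<Gamma>. \<exists>k\<ge>2. r = power_rel a k \<and> \<iota> a \<in> K))"

definition conj_part :: "('a word \<times> 'a word) set \<Rightarrow> ('a word \<times> 'a word) set"
  where "conj_part R = {r \<in> R. \<exists>a b c. r = conj_rel a b c}"

definition artin_lift :: "'a set \<Rightarrow> ('a word \<times> 'a word) set \<Rightarrow> 'a word set monoid"
  where "artin_lift \<Gamma> R = presented_group \<Gamma> (conj_part R)"

definition artin_gen :: "'a set \<Rightarrow> ('a word \<times> 'a word) set \<Rightarrow> 'a \<Rightarrow> 'a word set"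
  where "artin_gen \<Gamma> R a = presented_gen \<Gamma> (conj_part R) a"


section \<open>Dehn quandles and associated groups\<close>

definition as_rels :: "'q set \<Rightarrow> ('q \<Rightarrow> 'q \<Rightarrow> 'q) \<Rightarrow> ('q word \<times> 'q word) set"
  where "as_rels Q tri =
    {([(a, True), (b, True)], [(b, True), (tri a b, True)]) | a b. a \<in> Q \<and> b \<in> Q}"

definition associated_group :: "'q set \<Rightarrow> ('q \<Rightarrow> 'q \<Rightarrow> 'q) \<Rightarrow> 'q word set monoid"
  where "associated_group Q tri = presented_group Q (as_rels Q tri)"

definition dehn_quandle :: "('g, 'm) monoid_scheme \<Rightarrow> 'g set \<Rightarrow> 'g set"
  where "dehn_quandle G A = (\<Union>x\<in>A. conj_class G x)"

definition dehn_lift :: "('g, 'm) monoid_scheme \<Rightarrow> 'g set \<Rightarrow> 'g word set monoid"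
  where "dehn_lift G A = associated_group (dehn_quandle G A) (conj_op G)"

definition dehn_gen :: "('g, 'm) monoid_scheme \<Rightarrow> 'g set \<Rightarrow> 'g \<Rightarrow> 'g word set"
  where "dehn_gen G A x = presented_gen (dehn_quandle G A) (as_rels (dehn_quandle G A) (conj_op G)) x"

text \<open>The library's \<open>ord\<close> is 0 on elements of infinite order.\<close>

definition fin_gen_classes :: "('g, 'm) monoid_scheme \<Rightarrow> 'g set \<Rightarrow> 'g set set"
  where "fin_gen_classes G A = {K \<in> conj_classes G. \<exists>x \<in> A \<inter> K. group.ord G x \<noteq> 0}"

end

theory Submission
  imports Defs
begin

text \<open>
  Let \<open>H\<close> be the quotient of the Artin-type lift in which \<open>a\<^sup>k\<close> is central for every power relation
  \<open>a\<^sup>k = 1\<close>. The kernel of \<open>H \<rightarrow> G\<close> is generated by these central elements. For a generator \<open>c\<close>,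
  counting occurrences of the conjugates of \<open>c\<close> gives a homomorphism \<open>deg c : H \<rightarrow> \<int>\<close>; since there is
  at most one power relation per class, these homomorphisms show that the elements \<open>a\<^sup>k\<close> form a basis
  of the kernel, and that generators conjugate in \<open>G\<close> are already conjugate in \<open>H\<close> (this uses
  \<open>k \<noteq> 1\<close>). Two conjugates of generators in \<open>H\<close> with the same image in \<open>G\<close> therefore differ by an
  element of the kernel on which all degrees vanish, so they are equal. Hence every element of the
  Dehn quandle lifts canonically to \<open>H\<close>, and this lifting is inverse to \<open>H \<rightarrow> G\<^sup>D\<close>.
\<close>

section \<open>Presented groups\<close>

text \<open>The obstacle is that \<open>H\<close> satisfies by definition only the listed
  conjugation relations, while the associated group has one for every pair of elements of the Dehn
  quandle. A conjugation identity of \<open>G\<close> lifts to \<open>H\<close> only up to a factor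
  from the kernel, and the degrees must show that this factor is trivial. They can compare two lifts
  only once these are known to lie over one class of \<open>H\<close>, so conjugacy in
  \<open>G\<close> has to be pulled back first. If it failed for generators \<open>a\<close> and
  \<open>b\<close>, some kernel element \<open>u^-1 a u b^-1\<close> would have degree 1 at
  \<open>a\<close>; but on the kernel the degree at \<open>a\<close> is a multiple of the exponent
  in the class of \<open>a\<close>, or zero if there is no power relation. Two exponents in a class
  could be coprime, and divisibility would then say nothing. The same divisibility shows that a
  generator of finite order is conjugate to one that carries a power relation, which matches the
  basis with the classes in the theorem. The map from \<open>H\<close> to the associated group
  exists for a reason independent of the presentation: the associated group conjugates its
  generators through \<open>G\<close>, so the kernel of its map to \<open>G\<close> is central, and
  this kernel contains all \<open>e_a^k\<close>.\<close>

abbreviation word_class :: "'a set \<Rightarrow> ('a word \<times> 'a word) set \<Rightarrow> 'a word \<Rightarrow> 'a word set"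
  where "word_class S R w \<equiv> word_cong S R `` {w}"

lemma words_append_iff [simp]: "u @ v \<in> words S \<longleftrightarrow> u \<in> words S \<and> v \<in> words S"
  by (auto simp: words_def)

lemma words_Nil [simp]: "[] \<in> words S"
  by (auto simp: words_def)

lemma words_Cons_iff [simp]: "(a, s) # w \<in> words S \<longleftrightarrow> a \<in> S \<and> w \<in> words S"
  by (auto simp: words_def)

lemma words_replicate [simp]: "a \<in> S \<Longrightarrow> replicate k (a, s) \<in> words S"
  by (induction k) auto

lemma word_cong_words: "(u, v) \<in> word_cong S R \<Longrightarrow> u \<in> words S \<and> v \<in> words S"
  by (induction rule: word_cong.induct) auto

lemma equiv_word_cong: "equiv (words S) (word_cong S R)"
proof (rule equivI)
  show "word_cong S R \<subseteq> words S \<times> words S"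
    using word_cong_words by force
  show "refl_on (words S) (word_cong S R)"
    by (auto simp: refl_on_def intro: word_cong.refl)
  show "sym (word_cong S R)" by (auto simp: sym_def intro: word_cong.sym)
  show "trans (word_cong S R)" by (auto simp: trans_def intro: word_cong.trans)
qed

lemma word_class_eq_iff:
  "u \<in> words S \<Longrightarrow> v \<in> words S \<Longrightarrow> word_class S R u = word_class S R v \<longleftrightarrow> (u, v) \<in> word_cong S R"
  by (rule eq_equiv_class_iff[OF equiv_word_cong])

lemma word_class_relation:
  "(u, v) \<in> R \<Longrightarrow> u \<in> words S \<Longrightarrow> v \<in> words S \<Longrightarrow> word_class S R u = word_class S R v"
  by (simp add: word_class_eq_iff word_cong.relation)

lemma word_class_in_carrier [simp]:
  "w \<in> words S \<Longrightarrow> word_class S R w \<in> carrier (presented_group S R)"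
  by (simp add: presented_group_def quotientI)

lemma presented_group_cases:
  assumes "x \<in> carrier (presented_group S R)"
  obtains w where "w \<in> words S" "x = word_class S R w"
  using assms by (auto simp: presented_group_def elim: quotientE)

lemma presented_group_one: "\<one>\<^bsub>presented_group S R\<^esub> = word_class S R []"
  by (simp add: presented_group_def)

text \<open>The product is defined as a union over all pairs of representatives; the
  \<open>append\<close> rule makes all members of this union the same class.\<close>

lemma presented_group_mult:
  assumes "u \<in> words S" "v \<in> words S"
  shows "word_class S R u \<otimes>\<^bsub>presented_group S R\<^esub> word_class S R v = word_class S R (u @ v)"
proof -
  have eq: "word_class S R (u' @ v') = word_class S R (u @ v)"
    if "u' \<in> word_class S R u" "v' \<in> word_class S R v" for u' v'
  proof -
    have "(u, u') \<in> word_cong S R" "(v, v') \<in> word_cong S R"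
      using that by auto
    then have "(u @ v, u' @ v') \<in> word_cong S R"
      by (rule word_cong.append)
    then show ?thesis
      using equiv_class_eq[OF equiv_word_cong] by metis
  qed
  have "u \<in> word_class S R u" "v \<in> word_class S R v"
    using assms by (simp_all add: word_cong.refl)
  then have "(\<Union>u'\<in>word_class S R u. \<Union>v'\<in>word_class S R v. word_class S R (u' @ v')) =
      word_class S R (u @ v)"
    using eq by blast
  then show ?thesis
    by (simp add: presented_group_def)
qed

definition word_inv :: "'a word \<Rightarrow> 'a word"
  where "word_inv w = rev (map (\<lambda>(a, s). (a, \<not> s)) w)"

lemma word_inv_words: "w \<in> words S \<Longrightarrow> word_inv w \<in> words S"
  by (induction w) (auto simp: word_inv_def)

lemma word_inv_cong: "w \<in> words S \<Longrightarrow> (word_inv w @ w, []) \<in> word_cong S R"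
proof (induction w)
  case Nil
  then show ?case by (simp add: word_inv_def word_cong.refl)
next
  case (Cons l w)
  obtain a s where l: "l = (a, s)" by force
  have a: "a \<in> S" and w: "w \<in> words S" using Cons.prems l by auto
  have "([(a, \<not> s), (a, s)], []) \<in> word_cong S R"
    using word_cong.cancel[OF a, of "\<not> s"] by simp
  then have "(word_inv w @ ([(a, \<not> s), (a, s)] @ w), word_inv w @ ([] @ w)) \<in> word_cong S R"
    by (intro word_cong.append word_cong.refl word_inv_words w)
  also have "word_inv w @ ([(a, \<not> s), (a, s)] @ w) = word_inv (l # w) @ l # w"
    by (simp add: word_inv_def l)
  finally show ?case
    using Cons.IH[OF w] by (simp add: word_cong.trans)
qed

lemma group_presented_group [simp]: "group (presented_group S R)"
proof (rule groupI)
  fix x y z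
  assume "x \<in> carrier (presented_group S R)" "y \<in> carrier (presented_group S R)"
    "z \<in> carrier (presented_group S R)"
  then obtain u v w where
    "u \<in> words S" "x = word_class S R u" "v \<in> words S" "y = word_class S R v"
    "w \<in> words S" "z = word_class S R w"
    by (metis presented_group_cases)
  then show "x \<otimes>\<^bsub>presented_group S R\<^esub> y \<in> carrier (presented_group S R)"
    and "x \<otimes>\<^bsub>presented_group S R\<^esub> y \<otimes>\<^bsub>presented_group S R\<^esub> z =
         x \<otimes>\<^bsub>presented_group S R\<^esub> (y \<otimes>\<^bsub>presented_group S R\<^esub> z)"
    and "\<one>\<^bsub>presented_group S R\<^esub> \<otimes>\<^bsub>presented_group S R\<^esub> x = x"
    by (simp_all add: presented_group_mult presented_group_one)
next
  fix x assume "x \<in> carrier (presented_group S R)"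
  then obtain u where u: "u \<in> words S" "x = word_class S R u"
    by (metis presented_group_cases)
  then have "word_class S R (word_inv u) \<otimes>\<^bsub>presented_group S R\<^esub> x = \<one>\<^bsub>presented_group S R\<^esub>"
    by (simp add: presented_group_mult presented_group_one word_inv_words word_class_eq_iff
        word_inv_cong)
  then show "\<exists>y\<in>carrier (presented_group S R). y \<otimes>\<^bsub>presented_group S R\<^esub> x = \<one>\<^bsub>presented_group S R\<^esub>"
    using u word_inv_words by force
qed (simp add: presented_group_one)

lemma presented_gen_closed [simp]:
  "a \<in> S \<Longrightarrow> presented_gen S R a \<in> carrier (presented_group S R)"
  by (simp add: presented_gen_def)

section \<open>Evaluation of words and the universal property of presented groups\<close>

fun word_eval :: "('h, 'm) monoid_scheme \<Rightarrow> ('a \<Rightarrow> 'h) \<Rightarrow> 'a word \<Rightarrow> 'h" where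
  "word_eval H h [] = \<one>\<^bsub>H\<^esub>"
| "word_eval H h ((a, s) # w) = (if s then h a else inv\<^bsub>H\<^esub> (h a)) \<otimes>\<^bsub>H\<^esub> word_eval H h w"

context group
begin

lemma word_eval_closed:
  "h \<in> S \<rightarrow> carrier G \<Longrightarrow> w \<in> words S \<Longrightarrow> word_eval G h w \<in> carrier G"
  by (induction w) (auto simp: Pi_iff)

lemma word_eval_append:
  assumes "h \<in> S \<rightarrow> carrier G" "u \<in> words S" "v \<in> words S"
  shows "word_eval G h (u @ v) = word_eval G h u \<otimes> word_eval G h v"
  using assms(2)
proof (induction u)
  case Nil
  then show ?case using assms by (simp add: word_eval_closed)
next
  case (Cons l u)
  then obtain a s where "l = (a, s)" "a \<in> S" "u \<in> words S" by (cases l) auto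
  moreover from this have "h a \<in> carrier G" using assms by auto
  ultimately show ?case
    using Cons.IH assms by (auto simp: m_assoc word_eval_closed)
qed

lemma word_eval_replicate:
  "h a \<in> carrier G \<Longrightarrow> word_eval G h (replicate k (a, True)) = h a [^] k"
  by (induction k) (simp_all, metis nat_pow_Suc nat_pow_Suc2)

lemma word_eval_word_cong:
  assumes h: "h \<in> S \<rightarrow> carrier G"
    and R: "\<And>u v. (u, v) \<in> R \<Longrightarrow> u \<in> words S \<Longrightarrow> v \<in> words S \<Longrightarrow> word_eval G h u = word_eval G h v"
    and uv: "(u, v) \<in> word_cong S R"
  shows "word_eval G h u = word_eval G h v"
  using uv
proof (induction rule: word_cong.induct)
  case (append u v u' v')
  then show ?case
    using h by (auto simp: word_eval_append dest!: word_cong_words)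
next
  case (cancel a s)
  then have "h a \<in> carrier G" using h by auto
  then show ?case by (cases s) auto
qed (use R in auto)

lemma word_eval_in_generate:
  "w \<in> words S \<Longrightarrow> word_eval G h w \<in> generate G (h ` S)"
proof (induction w)
  case (Cons l w)
  then obtain a s where l: "l = (a, s)" "a \<in> S" and w: "w \<in> words S" by (cases l) auto
  from l have "h a \<in> h ` S" by blast
  then have "(if s then h a else inv (h a)) \<in> generate G (h ` S)"
    by (auto intro: generate.incl generate.inv)
  then show ?case
    using Cons.IH[OF w] l by (simp add: generate.eng)
qed (simp add: generate.one)

text \<open>Von Dyck's theorem. Evaluation is constant on congruence classes, so evaluating an
  arbitrary representative gives a homomorphism.\<close>

lemma presented_group_universal:
  assumes h: "h \<in> S \<rightarrow> carrier G"
    and R: "\<And>u v. (u, v) \<in> R \<Longrightarrow> u \<in> words S \<Longrightarrow> v \<in> words S \<Longrightarrow> word_eval G h u = word_eval G h v"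
  obtains \<phi> where "\<phi> \<in> hom (presented_group S R) G"
    "\<And>a. a \<in> S \<Longrightarrow> \<phi> (presented_gen S R a) = h a"
proof -
  define \<phi> where "\<phi> A = word_eval G h (SOME w. w \<in> A)" for A
  have \<phi>: "\<phi> (word_class S R w) = word_eval G h w" if w: "w \<in> words S" for w
  proof -
    have "(SOME u. u \<in> word_class S R w) \<in> word_class S R w"
      by (rule someI[of _ w]) (simp add: w word_cong.refl)
    then have "(w, SOME u. u \<in> word_class S R w) \<in> word_cong S R" by simp
    from word_eval_word_cong[OF h R this] show ?thesis
      by (simp add: \<phi>_def)
  qed
  show thesis
  proof
    show "\<phi> \<in> hom (presented_group S R) G"
    proof (rule homI)
      fix x y
      assume "x \<in> carrier (presented_group S R)" "y \<in> carrier (presented_group S R)"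
      then show "\<phi> x \<in> carrier G"
        and "\<phi> (x \<otimes>\<^bsub>presented_group S R\<^esub> y) = \<phi> x \<otimes> \<phi> y"
        by (auto elim!: presented_group_cases
            simp: presented_group_mult \<phi> word_eval_closed[OF h] word_eval_append[OF h])
    qed
    show "\<phi> (presented_gen S R a) = h a" if "a \<in> S" for a
      using that h by (simp add: presented_gen_def \<phi> Pi_iff)
  qed
qed

lemma hom_word_eval:
  assumes \<phi>: "\<phi> \<in> hom (presented_group S R) G" and w: "w \<in> words S"
  shows "\<phi> (word_class S R w) = word_eval G (\<phi> \<circ> presented_gen S R) w"
  using w
proof (induction w)
  case Nil
  have "\<phi> \<one>\<^bsub>presented_group S R\<^esub> = \<one>"
    by (rule hom_one[OF \<phi>]) simp_all
  then show ?case by (simp add: presented_group_one)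
next
  case (Cons l w)
  then obtain a s where l: "l = (a, s)" "a \<in> S" and w: "w \<in> words S" by (cases l) auto
  interpret P: group "presented_group S R" by simp
  interpret \<phi>: group_hom "presented_group S R" G \<phi>
    by unfold_locales (rule \<phi>)
  have inv: "word_class S R [(a, False)] = inv\<^bsub>presented_group S R\<^esub> presented_gen S R a"
  proof (rule P.inv_equality[symmetric])
    have "([(a, False), (a, True)], []) \<in> word_cong S R"
      using word_cong.cancel[OF l(2), of False] by simp
    then show "word_class S R [(a, False)] \<otimes>\<^bsub>presented_group S R\<^esub> presented_gen S R a =
          \<one>\<^bsub>presented_group S R\<^esub>"
      using l by (simp add: presented_gen_def presented_group_mult presented_group_one
          word_class_eq_iff)
  qed (use l in simp_all)
  have "word_class S R (l # w) = word_class S R [l] \<otimes>\<^bsub>presented_group S R\<^esub> word_class S R w"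
    using l w by (simp add: presented_group_mult)
  then have "\<phi> (word_class S R (l # w)) = \<phi> (word_class S R [l]) \<otimes> \<phi> (word_class S R w)"
    using l w by simp
  moreover have "\<phi> (word_class S R [l]) =
      (if s then \<phi> (presented_gen S R a) else inv \<phi> (presented_gen S R a))"
    using l inv by (simp add: \<phi>.hom_inv) (simp add: presented_gen_def)
  ultimately show ?case
    using Cons.IH[OF w] l by simp
qed

lemma hom_eq_on_generate:
  assumes "\<phi> \<in> hom G H" "\<psi> \<in> hom G H" "group H" "A \<subseteq> carrier G"
    and "\<And>a. a \<in> A \<Longrightarrow> \<phi> a = \<psi> a" and "x \<in> generate G A"
  shows "\<phi> x = \<psi> x"
proof -
  interpret \<phi>: group_hom G H \<phi>
    by (intro group_hom.intro group_hom_axioms.intro assms is_group)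
  interpret \<psi>: group_hom G H \<psi>
    by (intro group_hom.intro group_hom_axioms.intro assms is_group)
  show ?thesis
    using assms(6)
  proof (induction rule: generate.induct)
    case (eng x y)
    then show ?case
      using generate_in_carrier[OF assms(4)] by simp
  qed (use assms in \<open>auto simp: subset_iff\<close>)
qed

end

text \<open>This is \<open>hom_word_eval\<close> for the identity homomorphism; it converts
  statements about classes of words into computations with generators.\<close>

lemma word_class_eq_word_eval:
  assumes "w \<in> words S"
  shows "word_class S R w = word_eval (presented_group S R) (presented_gen S R) w"
proof -
  interpret P: group "presented_group S R" by simp
  have "(\<lambda>x. x) \<in> hom (presented_group S R) (presented_group S R)"
    by (simp add: hom_def)
  from P.hom_word_eval[OF this assms] show ?thesis
    by (simp add: o_def)
qed

lemma generate_presented_gen: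
  "generate (presented_group S R) (presented_gen S R ` S) = carrier (presented_group S R)"
proof -
  interpret P: group "presented_group S R" by simp
  have "generate (presented_group S R) (presented_gen S R ` S) \<subseteq> carrier (presented_group S R)"
    by (rule P.generate_incl) auto
  moreover have "x \<in> generate (presented_group S R) (presented_gen S R ` S)"
    if "x \<in> carrier (presented_group S R)" for x
    using that P.word_eval_in_generate
    by (auto elim!: presented_group_cases simp: word_class_eq_word_eval)
  ultimately show ?thesis by blast
qed

lemma presented_hom_eqI:
  assumes "\<phi> \<in> hom (presented_group S R) H" "\<psi> \<in> hom (presented_group S R) H" "group H"
    and "\<And>a. a \<in> S \<Longrightarrow> \<phi> (presented_gen S R a) = \<psi> (presented_gen S R a)"
    and "x \<in> carrier (presented_group S R)"
  shows "\<phi> x = \<psi> x"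
proof -
  interpret P: group "presented_group S R" by simp
  show ?thesis
    by (rule P.hom_eq_on_generate[of \<phi> H \<psi> "presented_gen S R ` S"])
      (use assms generate_presented_gen in auto)
qed

text \<open>
  If the relations \<open>R'\<close> hold modulo a normal subgroup \<open>M\<close>, then the kernel of the map onto the
  group presented by \<open>R'\<close> lies in \<open>M\<close>.
\<close>

lemma word_cong_imp_mem_normal:
  assumes M: "M \<lhd> presented_group S R"
    and R': "\<And>u v. (u, v) \<in> R' \<Longrightarrow> u \<in> words S \<Longrightarrow> v \<in> words S \<Longrightarrow>
      M #>\<^bsub>presented_group S R\<^esub> word_class S R u = M #>\<^bsub>presented_group S R\<^esub> word_class S R v"
    and w: "(w, []) \<in> word_cong S R'"
  shows "word_class S R w \<in> M"
proof -
  interpret normal M "presented_group S R" by (rule M)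
  interpret Q: group "presented_group S R Mod M" by (rule factorgroup_is_group)
  define q where "q x = M #>\<^bsub>presented_group S R\<^esub> x" for x
  have q: "q \<in> hom (presented_group S R) (presented_group S R Mod M)"
    using r_coset_hom_Mod by (simp add: q_def[abs_def])
  have ev: "q (word_class S R u) =
      word_eval (presented_group S R Mod M) (q \<circ> presented_gen S R) u" if "u \<in> words S" for u
    using Q.hom_word_eval[OF q that] .
  \<comment> \<open>The quotient by \<open>M\<close> satisfies the relations \<open>R'\<close>, so
    evaluation there cannot distinguish words that are congruent under \<open>R'\<close>.\<close>
  have "word_eval (presented_group S R Mod M) (q \<circ> presented_gen S R) w =
      word_eval (presented_group S R Mod M) (q \<circ> presented_gen S R) []"
  proof (rule Q.word_eval_word_cong[OF _ _ w])
    show "q \<circ> presented_gen S R \<in> S \<rightarrow> carrier (presented_group S R Mod M)"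
      using q by (auto simp: hom_def)
  next
    fix u v assume "(u, v) \<in> R'" "u \<in> words S" "v \<in> words S"
    then show "word_eval (presented_group S R Mod M) (q \<circ> presented_gen S R) u =
      word_eval (presented_group S R Mod M) (q \<circ> presented_gen S R) v"
      using R' by (simp add: q_def flip: ev)
  qed
  moreover have "w \<in> words S" using w word_cong_words by blast
  ultimately have "M #>\<^bsub>presented_group S R\<^esub> word_class S R w = M"
    by (simp add: q_def flip: ev)
  then show ?thesis
    using \<open>w \<in> words S\<close> coset_join1 subgroup_axioms by simp
qed

section \<open>Conjugation and central subgroups\<close>

context group
begin

lemma conj_op_closed [simp]:
  "a \<in> carrier G \<Longrightarrow> b \<in> carrier G \<Longrightarrow> conj_op G a b \<in> carrier G"
  by (simp add: conj_op_def)

lemma conj_op_one [simp]: "a \<in> carrier G \<Longrightarrow> conj_op G a \<one> = a"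
  by (simp add: conj_op_def)

lemma conj_op_mult:
  "a \<in> carrier G \<Longrightarrow> b \<in> carrier G \<Longrightarrow> c \<in> carrier G \<Longrightarrow>
    conj_op G a (b \<otimes> c) = conj_op G (conj_op G a b) c"
  by (simp add: conj_op_def inv_mult_group m_assoc)

lemma conj_op_inv_cancel [simp]:
  "a \<in> carrier G \<Longrightarrow> b \<in> carrier G \<Longrightarrow> conj_op G (conj_op G a b) (inv b) = a"
  by (simp flip: conj_op_mult)

lemma mult_conj_op:
  "a \<in> carrier G \<Longrightarrow> b \<in> carrier G \<Longrightarrow> b \<otimes> conj_op G a b = a \<otimes> b"
  by (simp add: conj_op_def flip: m_assoc)

text \<open>Translates between the shape of the conjugation relations in a presentation and the
  shape \<open>a b = b c\<close> used in \<open>as_rels\<close>.\<close>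

lemma conj_op_eq_iff:
  assumes "a \<in> carrier G" "b \<in> carrier G" "c \<in> carrier G"
  shows "conj_op G a b = c \<longleftrightarrow> a \<otimes> b = b \<otimes> c"
  using assms by (metis conj_op_closed l_cancel mult_conj_op)

lemma mem_conj_class_self: "a \<in> carrier G \<Longrightarrow> a \<in> conj_class G a"
  unfolding conj_class_def by (metis conj_op_one image_eqI one_closed)

lemma conj_class_subset: "a \<in> carrier G \<Longrightarrow> conj_class G a \<subseteq> carrier G"
  by (auto simp: conj_class_def)

lemma conj_class_conj_op:
  assumes a: "a \<in> carrier G" and b: "b \<in> carrier G"
  shows "conj_class G (conj_op G a b) = conj_class G a"
proof
  show "conj_class G (conj_op G a b) \<subseteq> conj_class G a"
    using a b by (auto simp: conj_class_def simp flip: conj_op_mult)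
  have "conj_op G a x \<in> conj_class G (conj_op G a b)" if x: "x \<in> carrier G" for x
  proof -
    have "conj_op G a x = conj_op G (conj_op G (conj_op G a b) (inv b)) x"
      using a b by simp
    also have "\<dots> = conj_op G (conj_op G a b) (inv b \<otimes> x)"
      using a b x by (simp add: conj_op_mult del: conj_op_inv_cancel)
    finally show ?thesis
      using b x by (auto simp: conj_class_def)
  qed
  then show "conj_class G a \<subseteq> conj_class G (conj_op G a b)"
    by (auto simp: conj_class_def)
qed

lemma conj_class_eq:
  "a \<in> carrier G \<Longrightarrow> b \<in> conj_class G a \<Longrightarrow> conj_class G b = conj_class G a"
  using conj_class_conj_op by (auto simp: conj_class_def[of G a])

section \<open>The centre and the subgroups generated by central elements\<close>

lemma group_center_closed: "z \<in> group_center G \<Longrightarrow> z \<in> carrier G"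
  by (simp add: group_center_def)

lemma group_center_commute:
  "z \<in> group_center G \<Longrightarrow> x \<in> carrier G \<Longrightarrow> z \<otimes> x = x \<otimes> z"
  by (simp add: group_center_def)

lemma subgroup_group_center: "subgroup (group_center G) G"
proof (rule subgroupI)
  show "group_center G \<subseteq> carrier G" by (auto simp: group_center_def)
  have "\<one> \<in> group_center G" by (simp add: group_center_def)
  then show "group_center G \<noteq> {}" by blast
next
  fix a assume a: "a \<in> group_center G"
  then have ac: "a \<in> carrier G" by (rule group_center_closed)
  have "inv a \<otimes> x = x \<otimes> inv a" if x: "x \<in> carrier G" for x
  proof -
    have "inv a \<otimes> x \<otimes> a = inv a \<otimes> (a \<otimes> x)"
      using ac x group_center_commute[OF a x] by (simp add: m_assoc)
    also have "\<dots> = x" using ac x by (simp flip: m_assoc)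
    finally show ?thesis using ac x by (simp add: inv_solve_right)
  qed
  then show "inv a \<in> group_center G"
    using ac by (simp add: group_center_def)
next
  fix a b assume ab: "a \<in> group_center G" "b \<in> group_center G"
  then have c: "a \<in> carrier G" "b \<in> carrier G" by (auto intro: group_center_closed)
  have "a \<otimes> b \<otimes> x = x \<otimes> (a \<otimes> b)" if x: "x \<in> carrier G" for x
  proof -
    have "a \<otimes> b \<otimes> x = a \<otimes> (x \<otimes> b)"
      using c x group_center_commute[OF ab(2) x] by (simp add: m_assoc)
    also have "\<dots> = x \<otimes> a \<otimes> b"
      using c x group_center_commute[OF ab(1) x] by (simp flip: m_assoc)
    finally show ?thesis using c x by (simp add: m_assoc)
  qed
  then show "a \<otimes> b \<in> group_center G"
    using c by (simp add: group_center_def)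
qed

text \<open>The universal property of the free abelian group asks for an abelian target; maps into
  \<open>G\<close> with central values are built through this subgroup.\<close>

lemma comm_group_group_center: "comm_group (G\<lparr>carrier := group_center G\<rparr>)"
  by (rule group.group_comm_groupI[OF subgroup_imp_group[OF subgroup_group_center]])
    (simp add: group_center_commute group_center_closed)

lemma generate_central_normal:
  assumes "A \<subseteq> group_center G"
  shows "generate G A \<lhd> G"
  unfolding normal_inv_iff
proof (intro conjI ballI)
  have A: "A \<subseteq> carrier G" using assms group_center_closed by blast
  then show "subgroup (generate G A) G" by (rule generate_is_subgroup)
  fix x h assume x: "x \<in> carrier G" and h: "h \<in> generate G A"
  then have "h \<in> group_center G"
    using generate_subgroup_incl[OF assms subgroup_group_center] by blast
  then have "x \<otimes> h \<otimes> inv x = h"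
    using x group_center_commute[of h x] group_center_closed[of h] by (simp add: inv_solve_right')
  then show "x \<otimes> h \<otimes> inv x \<in> generate G A" using h by simp
qed

section \<open>Normal closures and commutators\<close>

lemma normal_closure_normal:
  assumes "A \<subseteq> carrier G"
  shows "normal_closure G A \<lhd> G"
  unfolding normal_inv_iff
proof (intro conjI ballI)
  \<comment> \<open>The family of normal subgroups must be nonempty: the intersection of the empty
    family would be the whole type rather than a subgroup.\<close>
  have "carrier G \<lhd> G"
    unfolding normal_inv_iff by (auto intro: subgroup_self)
  then have ne: "{N. N \<lhd> G \<and> A \<subseteq> N} \<noteq> {}" using assms by blast
  show "subgroup (normal_closure G A) G"
    unfolding normal_closure_def
    by (rule subgroups_Inter) (use ne normal_inv_iff in auto)
  show "x \<otimes> h \<otimes> inv x \<in> normal_closure G A"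
    if "x \<in> carrier G" "h \<in> normal_closure G A" for x h
    using that unfolding normal_closure_def by (auto simp: normal_inv_iff)
qed

lemma subset_normal_closure: "A \<subseteq> normal_closure G A"
  by (auto simp: normal_closure_def)

lemma normal_closure_minimal: "N \<lhd> G \<Longrightarrow> A \<subseteq> N \<Longrightarrow> normal_closure G A \<subseteq> N"
  by (auto simp: normal_closure_def)

lemma commutator_eq_one_iff:
  assumes "x \<in> carrier G" "y \<in> carrier G"
  shows "commutator G x y = \<one> \<longleftrightarrow> x \<otimes> y = y \<otimes> x"
proof -
  have "commutator G x y = inv (y \<otimes> x) \<otimes> (x \<otimes> y)"
    using assms by (simp add: commutator_def inv_mult_group m_assoc)
  then show ?thesis
    using assms inv_solve_left'[of \<one> "y \<otimes> x" "x \<otimes> y"] by simp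
qed

text \<open>Equality of these cosets asks for \<open>x y (y x)^-1\<close> in \<open>N\<close>,
  whereas the commutator is \<open>(y x)^-1 x y\<close>; the two are conjugate by
  \<open>y x\<close>, and \<open>N\<close> is normal.\<close>

lemma rcos_mult_commute_of_commutator:
  assumes N: "N \<lhd> G" and c: "commutator G x y \<in> N" and x: "x \<in> carrier G" and y: "y \<in> carrier G"
  shows "N #> (x \<otimes> y) = N #> (y \<otimes> x)"
proof (rule coset_mult_inv1)
  have "commutator G x y = inv (y \<otimes> x) \<otimes> (x \<otimes> y)"
    using x y by (simp add: commutator_def inv_mult_group m_assoc)
  moreover have "(y \<otimes> x) \<otimes> (inv (y \<otimes> x) \<otimes> (x \<otimes> y)) = x \<otimes> y"
    using x y m_assoc[of "y \<otimes> x" "inv (y \<otimes> x)" "x \<otimes> y"] by simp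
  ultimately have "x \<otimes> y \<otimes> inv (y \<otimes> x) = (y \<otimes> x) \<otimes> commutator G x y \<otimes> inv (y \<otimes> x)"
    by simp
  then have "x \<otimes> y \<otimes> inv (y \<otimes> x) \<in> N"
    using N c x y by (simp add: normal_inv_iff)
  then show "N #> (x \<otimes> y \<otimes> inv (y \<otimes> x)) = N"
    using N x y by (intro coset_join2) (auto simp: normal_inv_iff)
  show "N \<subseteq> carrier G" using N by (simp add: normal_inv_iff subgroup.subset)
qed (use x y in auto)

text \<open>The matrix of values \<open>\<delta> r (z s)\<close> is diagonal with nonzero diagonal
  entries, so \<open>\<delta> r\<close> recovers the coordinate at \<open>r\<close> up to a nonzero
  integer factor. This makes the map from the free abelian group injective. The last conclusion,
  detection of the identity by the \<open>\<delta> r\<close>, is what later gives uniqueness of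
  lifts.\<close>

lemma central_family_free:
  fixes z :: "'p \<Rightarrow> 'a" and \<delta> :: "'p \<Rightarrow> 'a \<Rightarrow> int"
  assumes z: "\<And>r. r \<in> P \<Longrightarrow> z r \<in> group_center G"
    and \<delta>: "\<And>r. r \<in> P \<Longrightarrow> \<delta> r \<in> hom G integer_group"
    and nz: "\<And>r. r \<in> P \<Longrightarrow> \<delta> r (z r) \<noteq> 0"
    and ortho: "\<And>r s. r \<in> P \<Longrightarrow> s \<in> P \<Longrightarrow> r \<noteq> s \<Longrightarrow> \<delta> r (z s) = 0"
  obtains i where "i \<in> mon (free_Abelian_group P) G"
    "i ` carrier (free_Abelian_group P) = generate G (z ` P)"
    "\<And>x. x \<in> generate G (z ` P) \<Longrightarrow> (\<And>r. r \<in> P \<Longrightarrow> \<delta> r x = 0) \<Longrightarrow> x = \<one>"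
proof -
  interpret C: comm_group "G\<lparr>carrier := group_center G\<rparr>"
    by (rule comm_group_group_center)
  have "z ` P \<subseteq> carrier (G\<lparr>carrier := group_center G\<rparr>)" using z by auto
  then obtain i
    where i: "i \<in> hom (free_Abelian_group P) (G\<lparr>carrier := group_center G\<rparr>)"
      and iz: "\<And>r. r \<in> P \<Longrightarrow> i (frag_of r) = z r"
    by (rule C.free_Abelian_group_universal) blast
  have i: "i \<in> hom (free_Abelian_group P) G"
  proof (rule homI)
    fix x y assume x: "x \<in> carrier (free_Abelian_group P)" and y: "y \<in> carrier (free_Abelian_group P)"
    show "i x \<in> carrier G"
      using hom_in_carrier[OF i x] subgroup.subset[OF subgroup_group_center] by auto
    show "i (x \<otimes>\<^bsub>free_Abelian_group P\<^esub> y) = i x \<otimes> i y"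
      using hom_mult[OF i x y] by simp
  qed
  interpret F: group "free_Abelian_group P" by simp
  interpret i: group_hom "free_Abelian_group P" G i
    by unfold_locales (rule i)
  have gen: "carrier (free_Abelian_group P) = generate (free_Abelian_group P) (frag_of ` P)"
  proof
    show "generate (free_Abelian_group P) (frag_of ` P) \<subseteq> carrier (free_Abelian_group P)"
      by (rule F.generate_incl) auto
    have "x \<in> generate (free_Abelian_group P) (frag_of ` P)" if "Poly_Mapping.keys x \<subseteq> P" for x
      using that
    proof (induction rule: free_Abelian_group_induct[consumes 1, case_names zero diff frag_of])
      case zero
      then show ?case using generate.one[of "free_Abelian_group P"] by simp
    next
      case (diff x y)
      have "inv\<^bsub>free_Abelian_group P\<^esub> y \<in> generate (free_Abelian_group P) (frag_of ` P)"
        by (rule F.generate_m_inv_closed) (use diff in auto)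
      then show ?case
        using diff generate.eng[of x "free_Abelian_group P" _ "inv\<^bsub>free_Abelian_group P\<^esub> y"] by simp
    next
      case (frag_of a)
      then show ?case by (auto intro: generate.incl)
    qed
    then show "carrier (free_Abelian_group P) \<subseteq> generate (free_Abelian_group P) (frag_of ` P)"
      by auto
  qed
  have image: "i ` carrier (free_Abelian_group P) = generate G (z ` P)"
  proof -
    have "i ` carrier (free_Abelian_group P) = generate G (i ` frag_of ` P)"
      by (subst gen, rule i.generate_img[symmetric]) auto
    also have "i ` frag_of ` P = z ` P"
      using iz by (auto simp: image_image intro!: image_cong)
    finally show ?thesis .
  qed
  have coord: "\<delta> r (i x) = poly_mapping.lookup x r * \<delta> r (z r)"
    if x: "Poly_Mapping.keys x \<subseteq> P" and r: "r \<in> P" for x r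
  proof -
    interpret D: group_hom G integer_group "\<delta> r"
      by (intro group_hom.intro group_hom_axioms.intro \<delta> r is_group group_integer_group)
    show ?thesis
      using x
    proof (induction rule: free_Abelian_group_induct[consumes 1, case_names zero diff frag_of])
      case zero
      then show ?case using i.hom_one D.hom_one by simp
    next
      case (diff x y)
      have "i (x - y) = i x \<otimes> inv i y"
        using i.hom_mult[of x "- y"] i.hom_inv[of y] diff by simp
      moreover have "i x \<in> carrier G" "i y \<in> carrier G" using diff i.hom_closed by auto
      ultimately show ?case
        using diff D.hom_inv[of "i y"] by (simp add: lookup_minus algebra_simps)
    next
      case (frag_of s)
      then show ?case using iz ortho r by auto
    qed
  qed
  have zero: "x = 0" if x: "Poly_Mapping.keys x \<subseteq> P" and 0: "\<And>r. r \<in> P \<Longrightarrow> \<delta> r (i x) = 0" for x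
  proof (rule poly_mapping_eqI)
    fix r
    show "poly_mapping.lookup x r = poly_mapping.lookup 0 r"
    proof (cases "r \<in> P")
      case True
      then show ?thesis using coord[OF x True] 0 nz by simp
    next
      case False
      then show ?thesis using x by (auto simp: in_keys_iff)
    qed
  qed
  show thesis
  proof
    have "x = 0" if "Poly_Mapping.keys x \<subseteq> P" "i x = \<one>" for x
    proof (rule zero)
      fix r assume "r \<in> P"
      then show "\<delta> r (i x) = 0"
        using hom_one[OF \<delta> is_group group_integer_group] that by simp
    qed (fact that)
    then show "i \<in> mon (free_Abelian_group P) G"
      by (auto simp: mon_iff_hom_one[OF F.is_group is_group] i)
    show "i ` carrier (free_Abelian_group P) = generate G (z ` P)" by (rule image)
    fix x assume x: "x \<in> generate G (z ` P)" and 0: "\<And>r. r \<in> P \<Longrightarrow> \<delta> r x = 0"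
    then obtain y where "Poly_Mapping.keys y \<subseteq> P" "x = i y"
      unfolding image[symmetric] by auto
    then show "x = \<one>" using zero 0 i.hom_one by auto
  qed
qed

end

lemma (in group_hom) hom_conj_op:
  "a \<in> carrier G \<Longrightarrow> b \<in> carrier G \<Longrightarrow> h (conj_op G a b) = conj_op H (h a) (h b)"
  by (simp add: conj_op_def)

lemma (in group_hom) hom_commutator:
  "x \<in> carrier G \<Longrightarrow> y \<in> carrier G \<Longrightarrow> h (commutator G x y) = commutator H (h x) (h y)"
  by (simp add: commutator_def)

section \<open>Associated groups of Dehn quandles\<close>

text \<open>Inner automorphisms are treated as homomorphisms so that centrality can be tested on
  generators alone.\<close>

lemma (in group) conj_op_hom: "b \<in> carrier G \<Longrightarrow> (\<lambda>x. conj_op G x b) \<in> hom G G"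
proof (rule homI)
  fix x y assume b: "b \<in> carrier G" and x: "x \<in> carrier G" and y: "y \<in> carrier G"
  have "b \<otimes> (conj_op G x b \<otimes> conj_op G y b) = x \<otimes> b \<otimes> conj_op G y b"
    using b x y by (simp add: mult_conj_op flip: m_assoc)
  also have "\<dots> = x \<otimes> y \<otimes> b"
    using b x y by (simp add: mult_conj_op m_assoc)
  finally have "x \<otimes> y \<otimes> b = b \<otimes> (conj_op G x b \<otimes> conj_op G y b)" ..
  then show "conj_op G (x \<otimes> y) b = conj_op G x b \<otimes> conj_op G y b"
    using b x y by (subst conj_op_eq_iff) auto
qed simp

locale dehn_quandle_group = group G for G (structure) +
  fixes A assumes A: "A \<subseteq> carrier G"
begin

abbreviation "Q \<equiv> dehn_quandle G A"
abbreviation "GD \<equiv> dehn_lift G A"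
abbreviation "e \<equiv> dehn_gen G A"

lemma quandle_closed: "x \<in> Q \<Longrightarrow> x \<in> carrier G"
  using A conj_class_subset unfolding dehn_quandle_def by blast

lemma quandle_conj: "x \<in> Q \<Longrightarrow> b \<in> carrier G \<Longrightarrow> conj_op G x b \<in> Q"
proof -
  assume "x \<in> Q" and b: "b \<in> carrier G"
  then obtain a c where a: "a \<in> A" "c \<in> carrier G" "x = conj_op G a c"
    by (auto simp: dehn_quandle_def conj_class_def)
  then have "conj_op G x b = conj_op G a (c \<otimes> b)"
    using A b by (auto simp: conj_op_mult)
  then show ?thesis
    using a b unfolding dehn_quandle_def conj_class_def by blast
qed

lemma gen_in_quandle: "a \<in> A \<Longrightarrow> a \<in> Q"
  using A mem_conj_class_self unfolding dehn_quandle_def by blast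

lemma group_GD [simp]: "group GD"
  by (simp add: dehn_lift_def associated_group_def)

lemma e_closed [simp]: "x \<in> Q \<Longrightarrow> e x \<in> carrier GD"
  by (simp add: dehn_lift_def associated_group_def dehn_gen_def)

lemma generate_e: "generate GD (e ` Q) = carrier GD"
  unfolding dehn_lift_def associated_group_def dehn_gen_def[abs_def] by (rule generate_presented_gen)

lemma GD_hom_eqI:
  assumes "\<phi> \<in> hom GD K" "\<psi> \<in> hom GD K" "group K"
    and "\<And>x. x \<in> Q \<Longrightarrow> \<phi> (e x) = \<psi> (e x)" and "y \<in> carrier GD"
  shows "\<phi> y = \<psi> y"
  using assms unfolding dehn_lift_def associated_group_def dehn_gen_def
  by (rule presented_hom_eqI)

lemma conj_e: 
  assumes x: "x \<in> Q" and y: "y \<in> Q"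
  shows "conj_op GD (e x) (e y) = e (conj_op G x y)"
proof -
  interpret D: group GD by simp
  have xy: "conj_op G x y \<in> Q" using x y quandle_conj quandle_closed by blast
  have "([(x, True), (y, True)], [(y, True), (conj_op G x y, True)]) \<in> as_rels Q (conj_op G)"
    using x y by (auto simp: as_rels_def)
  then have "word_class Q (as_rels Q (conj_op G)) [(x, True), (y, True)] =
      word_class Q (as_rels Q (conj_op G)) [(y, True), (conj_op G x y, True)]"
    by (rule word_class_relation) (use x y xy in auto)
  then have "e x \<otimes>\<^bsub>GD\<^esub> e y = e y \<otimes>\<^bsub>GD\<^esub> e (conj_op G x y)"
    using x y xy
    by (simp add: dehn_lift_def associated_group_def dehn_gen_def presented_gen_def
        presented_group_mult)
  then show ?thesis
    using D.conj_op_eq_iff[of "e x" "e y" "e (conj_op G x y)"] x y xy by simp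
qed

text \<open>The associated group is left adjoint to taking the conjugation quandle: \<open>h\<close>
  is a quandle homomorphism from \<open>Q\<close> to \<open>K\<close> with conjugation, and
  \<open>\<phi>\<close> is its adjoint.\<close>

lemma GD_universal:
  assumes "group K" and h: "h \<in> Q \<rightarrow> carrier K"
    and conj: "\<And>x y. x \<in> Q \<Longrightarrow> y \<in> Q \<Longrightarrow> conj_op K (h x) (h y) = h (conj_op G x y)"
  obtains \<phi> where "\<phi> \<in> hom GD K" "\<And>x. x \<in> Q \<Longrightarrow> \<phi> (e x) = h x"
proof -
  interpret K: group K by fact
  have "word_eval K h u = word_eval K h v" if uv_in: "(u, v) \<in> as_rels Q (conj_op G)" for u v
  proof -
    obtain x y where uv: "u = [(x, True), (y, True)]" "v = [(y, True), (conj_op G x y, True)]"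
      and xy: "x \<in> Q" "y \<in> Q"
      using uv_in by (auto simp: as_rels_def)
    have "h x \<in> carrier K" "h y \<in> carrier K" "h (conj_op G x y) \<in> carrier K"
      using h xy quandle_conj quandle_closed by blast+
    then show ?thesis
      using uv conj[OF xy] K.conj_op_eq_iff[of "h x" "h y" "h (conj_op G x y)"] by simp
  qed
  then obtain \<phi> where "\<phi> \<in> hom (presented_group Q (as_rels Q (conj_op G))) K"
    "\<And>x. x \<in> Q \<Longrightarrow> \<phi> (presented_gen Q (as_rels Q (conj_op G)) x) = h x"
    using K.presented_group_universal[OF h, of "as_rels Q (conj_op G)"] by metis
  then show thesis
    by (intro that[of \<phi>]) (simp_all add: dehn_lift_def associated_group_def dehn_gen_def)
qed

text \<open>The adjoint of the inclusion of \<open>Q\<close> into \<open>G\<close>. The choice is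
  harmless, since \<open>GD_hom_eqI\<close> shows that any two candidates agree on the
  carrier.\<close>

definition counit :: "'a word set \<Rightarrow> 'a"
  where "counit = (SOME g. g \<in> hom GD G \<and> (\<forall>x\<in>Q. g (e x) = x))"

lemma counit_hom: "counit \<in> hom GD G" and counit_e: "x \<in> Q \<Longrightarrow> counit (e x) = x"
proof -
  obtain g where "g \<in> hom GD G" "\<And>x. x \<in> Q \<Longrightarrow> g (e x) = x"
    by (rule GD_universal[OF is_group, of "\<lambda>x. x"]) (auto simp: quandle_closed)
  then have "\<exists>g. g \<in> hom GD G \<and> (\<forall>x\<in>Q. g (e x) = x)" by blast
  from someI_ex[OF this] show "counit \<in> hom GD G" "x \<in> Q \<Longrightarrow> counit (e x) = x"
    by (simp_all add: counit_def)
qed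

text \<open>The associated group acts on its generators through \<open>G\<close>. For
  \<open>y\<close> a generator this is the defining relation, and both sides are compatible with
  products and inverses in \<open>y\<close>.\<close>

lemma conj_e_counit:
  assumes "y \<in> carrier GD" "x \<in> Q"
  shows "conj_op GD (e x) y = e (conj_op G x (counit y))"
proof -
  interpret D: group GD by simp
  interpret g: group_hom GD G counit by unfold_locales (rule counit_hom)
  have eQ: "e ` Q \<subseteq> carrier GD" by auto
  have "y \<in> generate GD (e ` Q)" using assms generate_e by simp
  then show ?thesis
    using assms(2)
  proof (induction arbitrary: x rule: generate.induct)
    case one
    then show ?case by (simp add: quandle_closed)
  next
    case (incl y)
    then show ?case by (auto simp: conj_e counit_e)
  next
    case (inv y)
    then obtain b where b: "b \<in> Q" "y = e b" by blast
    \<comment> \<open>This is the quandle element that \<open>b\<close> conjugates to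
      \<open>x\<close>; the relation for \<open>x'\<close> and \<open>b\<close> is then read
      backwards.\<close>
    define x' where "x' = conj_op G x (inv b)"
    have x': "x' \<in> Q" unfolding x'_def using b inv.prems quandle_conj quandle_closed by simp
    have "conj_op G x' b = x"
      using b inv.prems quandle_closed conj_op_inv_cancel[of x "inv b"] by (simp add: x'_def)
    then have "conj_op GD (e x') (e b) = e x"
      using conj_e[OF x' b(1)] by simp
    then have "conj_op GD (e x) (inv\<^bsub>GD\<^esub> e b) = e x'"
      using D.conj_op_inv_cancel[of "e x'" "e b"] x' b by simp
    then show ?case
      using b by (simp add: counit_e x'_def)
  next
    case (eng y1 y2)
    have c: "y1 \<in> carrier GD" "y2 \<in> carrier GD"
      using eng.hyps D.generate_in_carrier[OF eQ] by auto
    have "conj_op GD (e x) (y1 \<otimes>\<^bsub>GD\<^esub> y2) = conj_op GD (conj_op GD (e x) y1) y2"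
      using c eng.prems by (simp add: D.conj_op_mult)
    also have "\<dots> = e (conj_op G (conj_op G x (counit y1)) (counit y2))"
      using eng.IH eng.prems quandle_conj c by simp
    also have "\<dots> = e (conj_op G x (counit (y1 \<otimes>\<^bsub>GD\<^esub> y2)))"
      using c eng.prems quandle_closed by (simp add: conj_op_mult)
    finally show ?case .
  qed
qed

text \<open>An element over \<open>\<one>\<close> fixes every generator \<open>e x\<close> under
  conjugation, by \<open>conj_e_counit\<close>. The argument works for any set of elements of
  \<open>G\<close> and involves no presentation.\<close>

lemma kernel_counit_central: "kernel GD G counit \<subseteq> group_center GD"
proof
  fix y assume "y \<in> kernel GD G counit"
  then have y: "y \<in> carrier GD" "counit y = \<one>" by (auto simp: kernel_def)
  interpret D: group GD by simp
  have "y \<otimes>\<^bsub>GD\<^esub> x = x \<otimes>\<^bsub>GD\<^esub> y" if x: "x \<in> carrier GD" for x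
  proof -
    have "conj_op GD x y = x"
    proof (rule GD_hom_eqI[OF D.conj_op_hom[OF y(1)] _ group_GD _ x])
      show "(\<lambda>x. x) \<in> hom GD GD" by (simp add: hom_def)
      show "conj_op GD (e x) y = e x" if "x \<in> Q" for x
        using conj_e_counit[OF y(1) that] y(2) that quandle_closed by simp
    qed
    then show ?thesis using D.conj_op_eq_iff[OF x y(1) x] by simp
  qed
  then show "y \<in> group_center GD" using y(1) unfolding group_center_def by blast
qed

end

section \<open>The intermediate group\<close>

text \<open>A nonempty power word shows its letter and its length. The bound matters because all
  power words with exponent 0 are the same empty word.\<close>

lemma power_rel_eq_iff: "2 \<le> k \<Longrightarrow> power_rel a k = power_rel b l \<longleftrightarrow> a = b \<and> k = l"
  by (cases k; cases l) (auto simp: power_rel_def)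

lemma power_rel_neq_conj_rel: "power_rel a k \<noteq> conj_rel b c d"
  by (simp add: power_rel_def conj_rel_def)

lemma word_eval_cong:
  "w \<in> words S \<Longrightarrow> (\<And>a. a \<in> S \<Longrightarrow> h a = h' a) \<Longrightarrow> word_eval G h w = word_eval G h' w"
proof (induction w)
  case (Cons l w)
  then show ?case by (cases l) auto
qed simp

text \<open>With the next fact, the conditions of \<open>H_universal\<close> for an integer-valued
  map reduce to equal values at \<open>a\<close> and \<open>c\<close> in each conjugation
  relation.\<close>

lemma conj_op_integer_group [simp]: "conj_op integer_group m n = m"
  by (simp add: conj_op_def)

lemma group_center_integer_group [simp]: "group_center integer_group = UNIV"
  by (auto simp: group_center_def)

lemma (in group) word_eval_conj_rel:
  assumes "h \<in> S \<rightarrow> carrier G" "a \<in> S" "b \<in> S" "c \<in> S"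
  shows "word_eval G h (fst (conj_rel a b c)) = conj_op G (h a) (h b)"
    and "word_eval G h (snd (conj_rel a b c)) = h c"
proof -
  have "h a \<in> carrier G" "h b \<in> carrier G" "h c \<in> carrier G" using assms by auto
  then show "word_eval G h (fst (conj_rel a b c)) = conj_op G (h a) (h b)"
    and "word_eval G h (snd (conj_rel a b c)) = h c"
    by (simp_all add: conj_rel_def conj_op_def m_assoc)
qed

locale Cbar = group G for G :: "('g, 'm) monoid_scheme" (structure) +
  fixes \<Gamma> :: "'a set" and R :: "('a word \<times> 'a word) set" and \<iota> :: "'a \<Rightarrow> 'g"
  assumes Cbar: "Cbar_presentation G \<Gamma> R \<iota>"
begin

text \<open>
  The group \<open>H\<close> below turns out to be isomorphic to the associated group of the Dehn quandle.
\<close>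

definition central_rels :: "('a word \<times> 'a word) set"
  where "central_rels = {(replicate k (a, True) @ w, w @ replicate k (a, True)) | a k w.
    a \<in> \<Gamma> \<and> power_rel a k \<in> R \<and> w \<in> words \<Gamma>}"

definition H_rels :: "('a word \<times> 'a word) set"
  where "H_rels = conj_part R \<union> central_rels"

definition H :: "'a word set monoid"
  where "H = presented_group \<Gamma> H_rels"

definition x :: "'a \<Rightarrow> 'a word set"
  where "x = presented_gen \<Gamma> H_rels"

definition H_central :: "'a word set set"
  where "H_central = {x a [^]\<^bsub>H\<^esub> k | a k. a \<in> \<Gamma> \<and> power_rel a k \<in> R}"

section \<open>Consequences of the presentation of \<open>G\<close>\<close>

lemma R_cases:
  assumes "r \<in> R"
  obtains (conj) a b c where "a \<in> \<Gamma>" "b \<in> \<Gamma>" "c \<in> \<Gamma>" "r = conj_rel a b c"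
  | (power) a k where "a \<in> \<Gamma>" "2 \<le> k" "r = power_rel a k"
  using Cbar assms unfolding Cbar_presentation_def by blast

lemma power_relD:
  assumes "power_rel a k \<in> R"
  shows "a \<in> \<Gamma>" "2 \<le> k"
  using assms
  by (rule R_cases; metis power_rel_neq_conj_rel power_rel_eq_iff)+

lemma conj_part_cases:
  assumes "r \<in> conj_part R"
  obtains a b c where "a \<in> \<Gamma>" "b \<in> \<Gamma>" "c \<in> \<Gamma>" "r = conj_rel a b c" "r \<in> R"
proof -
  have r: "r \<in> R" and "\<exists>a b c. r = conj_rel a b c"
    using assms by (auto simp: conj_part_def)
  from r show thesis
  proof (cases rule: R_cases)
    case (conj a b c)
    then show thesis using r that by blast
  next
    case (power a k)
    then show thesis
      using \<open>\<exists>a b c. r = conj_rel a b c\<close> power_rel_neq_conj_rel by metis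
  qed
qed

lemma presentation:
  obtains \<phi> where "\<phi> \<in> iso (presented_group \<Gamma> R) G" "\<And>a. a \<in> \<Gamma> \<Longrightarrow> \<phi> (presented_gen \<Gamma> R a) = \<iota> a"
  using Cbar unfolding Cbar_presentation_def is_presentation_def by blast

lemma \<iota>_closed: "a \<in> \<Gamma> \<Longrightarrow> \<iota> a \<in> carrier G"
proof -
  assume a: "a \<in> \<Gamma>"
  obtain \<phi> where \<phi>: "\<phi> \<in> iso (presented_group \<Gamma> R) G"
    "\<And>a. a \<in> \<Gamma> \<Longrightarrow> \<phi> (presented_gen \<Gamma> R a) = \<iota> a" by (rule presentation) blast
  have "\<phi> (presented_gen \<Gamma> R a) \<in> carrier G"
    using \<phi>(1) a by (intro hom_in_carrier[of \<phi> "presented_group \<Gamma> R"]) (auto simp: iso_def)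
  then show ?thesis using \<phi>(2) a by simp
qed

lemma \<iota>_funcset: "\<iota> \<in> \<Gamma> \<rightarrow> carrier G"
  using \<iota>_closed by blast

lemma presentation_word_eval:
  obtains \<phi> where "bij_betw \<phi> (carrier (presented_group \<Gamma> R)) (carrier G)"
    "\<And>w. w \<in> words \<Gamma> \<Longrightarrow> \<phi> (word_class \<Gamma> R w) = word_eval G \<iota> w"
proof -
  obtain \<phi> where \<phi>: "\<phi> \<in> iso (presented_group \<Gamma> R) G"
    "\<And>a. a \<in> \<Gamma> \<Longrightarrow> \<phi> (presented_gen \<Gamma> R a) = \<iota> a" by (rule presentation) blast
  then have hom: "\<phi> \<in> hom (presented_group \<Gamma> R) G" by (simp add: iso_def)
  have "\<phi> (word_class \<Gamma> R w) = word_eval G \<iota> w" if "w \<in> words \<Gamma>" for w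
    using hom_word_eval[OF hom that] word_eval_cong[OF that, of "\<phi> \<circ> presented_gen \<Gamma> R" \<iota> G] \<phi>(2)
    by simp
  then show thesis using \<phi>(1) by (intro that) (auto simp: iso_def)
qed

text \<open>This is injectivity of the presenting isomorphism. Through it, equalities in
  \<open>G\<close> become derivations from \<open>R\<close>.\<close>

lemma word_eval_eq_iff:
  assumes "u \<in> words \<Gamma>" "v \<in> words \<Gamma>"
  shows "word_eval G \<iota> u = word_eval G \<iota> v \<longleftrightarrow> (u, v) \<in> word_cong \<Gamma> R"
proof -
  obtain \<phi> where \<phi>: "bij_betw \<phi> (carrier (presented_group \<Gamma> R)) (carrier G)"
    "\<And>w. w \<in> words \<Gamma> \<Longrightarrow> \<phi> (word_class \<Gamma> R w) = word_eval G \<iota> w"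
    by (rule presentation_word_eval) blast
  have "word_eval G \<iota> u = word_eval G \<iota> v \<longleftrightarrow> word_class \<Gamma> R u = word_class \<Gamma> R v"
    using inj_on_eq_iff[OF bij_betw_imp_inj_on[OF \<phi>(1)], of "word_class \<Gamma> R u" "word_class \<Gamma> R v"]
      \<phi>(2) assms by simp
  then show ?thesis using assms by (simp add: word_class_eq_iff)
qed

lemma G_cases:
  assumes "g \<in> carrier G"
  obtains w where "w \<in> words \<Gamma>" "g = word_eval G \<iota> w"
proof -
  obtain \<phi> where \<phi>: "bij_betw \<phi> (carrier (presented_group \<Gamma> R)) (carrier G)"
    "\<And>w. w \<in> words \<Gamma> \<Longrightarrow> \<phi> (word_class \<Gamma> R w) = word_eval G \<iota> w"
    by (rule presentation_word_eval) blast
  then obtain y where y: "y \<in> carrier (presented_group \<Gamma> R)" "g = \<phi> y"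
    using assms by (auto simp: bij_betw_def)
  then obtain w where "w \<in> words \<Gamma>" "y = word_class \<Gamma> R w" by (elim presented_group_cases)
  then show thesis using that \<phi>(2) y by blast
qed

lemma conj_rel_G:
  assumes "conj_rel a b c \<in> R" "a \<in> \<Gamma>" "b \<in> \<Gamma>" "c \<in> \<Gamma>"
  shows "conj_op G (\<iota> a) (\<iota> b) = \<iota> c"
proof -
  have "word_eval G \<iota> (fst (conj_rel a b c)) = word_eval G \<iota> (snd (conj_rel a b c))"
    using assms by (subst word_eval_eq_iff) (auto simp: conj_rel_def intro!: word_cong.relation)
  then show ?thesis
    using word_eval_conj_rel[OF \<iota>_funcset] assms by simp
qed

lemma power_rel_G:
  assumes "power_rel a k \<in> R"
  shows "\<iota> a [^] k = \<one>"
proof -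
  have a: "a \<in> \<Gamma>" using power_relD[OF assms] by simp
  then have "word_eval G \<iota> (replicate k (a, True)) = word_eval G \<iota> []"
    using assms by (subst word_eval_eq_iff) (auto simp: power_rel_def intro!: word_cong.relation)
  then show ?thesis
    using word_eval_replicate[of \<iota> a k] \<iota>_closed[OF a] by simp
qed

text \<open>The at-most-one condition speaks of relations in \<open>R\<close>; here it is moved to
  pairs of a generator and an exponent, which \<open>power_rel_eq_iff\<close> permits since
  exponents are at least 2.\<close>

lemma power_rel_unique:
  assumes ak: "power_rel a k \<in> R" and bl: "power_rel b l \<in> R"
    and "conj_class G (\<iota> a) = conj_class G (\<iota> b)"
  shows "a = b \<and> k = l"
proof -
  have ab: "a \<in> \<Gamma>" "2 \<le> k" "b \<in> \<Gamma>" "2 \<le> l" using power_relD ak bl by auto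
  have "\<exists>\<^sub>\<le>\<^sub>1 r. r \<in> R \<and> (\<exists>a\<in>\<Gamma>. \<exists>k\<ge>2. r = power_rel a k \<and> \<iota> a \<in> conj_class G (\<iota> a'))"
    if "a' \<in> \<Gamma>" for a'
    using Cbar \<iota>_closed[OF that] unfolding Cbar_presentation_def conj_classes_def by blast
  from this[OF ab(1)] have "power_rel a k = power_rel b l"
  proof (rule Uniq_D)
    have "\<iota> a \<in> conj_class G (\<iota> a)" "\<iota> b \<in> conj_class G (\<iota> a)"
      using assms(3) ab mem_conj_class_self \<iota>_closed by auto
    then show "power_rel a k \<in> R \<and> (\<exists>a'\<in>\<Gamma>. \<exists>k'\<ge>2. power_rel a k = power_rel a' k' \<and> \<iota> a' \<in> conj_class G (\<iota> a))"
      and "power_rel b l \<in> R \<and> (\<exists>a'\<in>\<Gamma>. \<exists>k'\<ge>2. power_rel b l = power_rel a' k' \<and> \<iota> a' \<in> conj_class G (\<iota> a))"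
      using ak bl ab by blast+
  qed
  then show ?thesis using power_rel_eq_iff[OF ab(2), of a b l] by simp
qed

lemma word_eval_conj_part:
  assumes "group K" and h: "h \<in> \<Gamma> \<rightarrow> carrier K"
    and conj: "\<And>a b c. a \<in> \<Gamma> \<Longrightarrow> b \<in> \<Gamma> \<Longrightarrow> c \<in> \<Gamma> \<Longrightarrow> conj_rel a b c \<in> R \<Longrightarrow>
      conj_op K (h a) (h b) = h c"
    and "(u, v) \<in> conj_part R"
  shows "word_eval K h u = word_eval K h v"
  using assms(4)
proof (rule conj_part_cases)
  interpret K: group K by fact
  fix a b c assume "a \<in> \<Gamma>" "b \<in> \<Gamma>" "c \<in> \<Gamma>" "(u, v) = conj_rel a b c" "(u, v) \<in> R"
  then show ?thesis
    using K.word_eval_conj_rel[OF h, of a b c] conj[of a b c] by (metis fst_conv snd_conv)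
qed

section \<open>Universal properties of the Artin-type lift and of \<open>H\<close>\<close>

lemma artin_universal:
  assumes "group K" and h: "h \<in> \<Gamma> \<rightarrow> carrier K"
    and conj: "\<And>a b c. a \<in> \<Gamma> \<Longrightarrow> b \<in> \<Gamma> \<Longrightarrow> c \<in> \<Gamma> \<Longrightarrow> conj_rel a b c \<in> R \<Longrightarrow>
      conj_op K (h a) (h b) = h c"
  obtains \<phi> where "\<phi> \<in> hom (artin_lift \<Gamma> R) K" "\<And>a. a \<in> \<Gamma> \<Longrightarrow> \<phi> (artin_gen \<Gamma> R a) = h a"
proof -
  interpret K: group K by fact
  have "word_eval K h u = word_eval K h v" if "(u, v) \<in> conj_part R" for u v
    using word_eval_conj_part[OF assms(1) h conj that] .
  then obtain \<phi> where "\<phi> \<in> hom (presented_group \<Gamma> (conj_part R)) K"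
    "\<And>a. a \<in> \<Gamma> \<Longrightarrow> \<phi> (presented_gen \<Gamma> (conj_part R) a) = h a"
    by (rule K.presented_group_universal[OF h, of "conj_part R"]) blast+
  then show thesis
    by (intro that[of \<phi>]) (simp_all add: artin_lift_def artin_gen_def)
qed

lemma H_universal:
  assumes "group K" and h: "h \<in> \<Gamma> \<rightarrow> carrier K"
    and conj: "\<And>a b c. a \<in> \<Gamma> \<Longrightarrow> b \<in> \<Gamma> \<Longrightarrow> c \<in> \<Gamma> \<Longrightarrow> conj_rel a b c \<in> R \<Longrightarrow>
      conj_op K (h a) (h b) = h c"
    and central: "\<And>a k. a \<in> \<Gamma> \<Longrightarrow> power_rel a k \<in> R \<Longrightarrow> h a [^]\<^bsub>K\<^esub> k \<in> group_center K"
  obtains \<phi> where "\<phi> \<in> hom H K" "\<And>a. a \<in> \<Gamma> \<Longrightarrow> \<phi> (x a) = h a"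
proof -
  interpret K: group K by fact
  have "word_eval K h u = word_eval K h v" if "(u, v) \<in> conj_part R" for u v
    using word_eval_conj_part[OF assms(1) h conj that] .
  moreover have "word_eval K h u = word_eval K h v" if uv: "(u, v) \<in> central_rels" for u v
  proof -
    obtain a k w where w: "u = replicate k (a, True) @ w" "v = w @ replicate k (a, True)"
      "a \<in> \<Gamma>" "power_rel a k \<in> R" "w \<in> words \<Gamma>"
      using uv by (auto simp: central_rels_def)
    then have "h a \<in> carrier K" using h by blast
    then show ?thesis
      using w K.group_center_commute[OF central K.word_eval_closed[OF h, of w], of a k]
      by (simp add: K.word_eval_append[OF h] K.word_eval_replicate)
  qed
  ultimately have "word_eval K h u = word_eval K h v" if "(u, v) \<in> H_rels" for u v
    using that unfolding H_rels_def by blast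
  then obtain \<phi> where "\<phi> \<in> hom (presented_group \<Gamma> H_rels) K"
    "\<And>a. a \<in> \<Gamma> \<Longrightarrow> \<phi> (presented_gen \<Gamma> H_rels a) = h a"
    by (rule K.presented_group_universal[OF h, of "H_rels"]) blast+
  then show thesis
    by (intro that[of \<phi>]) (simp_all add: H_def x_def)
qed

lemma group_H [simp]: "group H"
  by (simp add: H_def)

lemma x_closed [simp]: "a \<in> \<Gamma> \<Longrightarrow> x a \<in> carrier H"
  by (simp add: H_def x_def)

lemma H_hom_eqI:
  assumes "\<phi> \<in> hom H K" "\<psi> \<in> hom H K" "group K"
    and "\<And>a. a \<in> \<Gamma> \<Longrightarrow> \<phi> (x a) = \<psi> (x a)" and "y \<in> carrier H"
  shows "\<phi> y = \<psi> y"
  using assms unfolding H_def x_def by (rule presented_hom_eqI)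

lemma H_cases:
  assumes "y \<in> carrier H"
  obtains w where "w \<in> words \<Gamma>" "y = word_eval H x w"
proof -
  from assms obtain w where "w \<in> words \<Gamma>" "y = word_class \<Gamma> H_rels w"
    unfolding H_def by (rule presented_group_cases)
  then show thesis by (intro that[of w]) (simp_all add: H_def x_def word_class_eq_word_eval)
qed

lemma x_funcset: "x \<in> \<Gamma> \<rightarrow> carrier H"
  by simp

lemma H_relation:
  assumes "(u, v) \<in> H_rels" "u \<in> words \<Gamma>" "v \<in> words \<Gamma>"
  shows "word_eval H x u = word_eval H x v"
  using word_class_relation[OF assms] assms by (simp add: H_def x_def word_class_eq_word_eval)

lemma conj_rel_H:
  assumes "a \<in> \<Gamma>" "b \<in> \<Gamma>" "c \<in> \<Gamma>" "conj_rel a b c \<in> R"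
  shows "conj_op H (x a) (x b) = x c"
proof -
  interpret H: group H by simp
  have "word_eval H x (fst (conj_rel a b c)) = word_eval H x (snd (conj_rel a b c))"
    by (rule H_relation) (use assms in \<open>auto simp: H_rels_def conj_part_def conj_rel_def\<close>)
  then show ?thesis
    using H.word_eval_conj_rel[OF x_funcset] assms by simp
qed

lemma power_central_H:
  assumes "a \<in> \<Gamma>" "power_rel a k \<in> R"
  shows "x a [^]\<^bsub>H\<^esub> k \<in> group_center H"
proof -
  interpret H: group H by simp
  have "x a [^]\<^bsub>H\<^esub> k \<otimes>\<^bsub>H\<^esub> y = y \<otimes>\<^bsub>H\<^esub> x a [^]\<^bsub>H\<^esub> k" if y: "y \<in> carrier H" for y
  proof -
    obtain w where w: "w \<in> words \<Gamma>" "y = word_eval H x w" using y by (rule H_cases)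
    have "word_eval H x (replicate k (a, True) @ w) = word_eval H x (w @ replicate k (a, True))"
      by (rule H_relation) (use assms w in \<open>auto simp: H_rels_def central_rels_def\<close>)
    then show ?thesis
      using assms w by (simp add: H.word_eval_append[OF x_funcset] H.word_eval_replicate)
  qed
  then show ?thesis
    unfolding group_center_def using assms by simp
qed

lemma H_central_central: "H_central \<subseteq> group_center H"
  using power_central_H unfolding H_central_def by blast

section \<open>The projection from \<open>H\<close> onto \<open>G\<close> and its kernel\<close>

definition proj :: "'a word set \<Rightarrow> 'g"
  where "proj = (SOME \<phi>. \<phi> \<in> hom H G \<and> (\<forall>a\<in>\<Gamma>. \<phi> (x a) = \<iota> a))"

lemma proj_hom: "proj \<in> hom H G" and proj_x: "a \<in> \<Gamma> \<Longrightarrow> proj (x a) = \<iota> a"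
proof -
  \<comment> \<open>The powers that have to be central are trivial in \<open>G\<close>.\<close>
  have "\<one> \<in> group_center G" by (simp add: group_center_def)
  then have "\<exists>\<phi>. \<phi> \<in> hom H G \<and> (\<forall>a\<in>\<Gamma>. \<phi> (x a) = \<iota> a)"
    by - (rule H_universal[OF is_group \<iota>_funcset], auto simp: conj_rel_G power_rel_G)
  from someI_ex[OF this] show "proj \<in> hom H G" "a \<in> \<Gamma> \<Longrightarrow> proj (x a) = \<iota> a"
    by (simp_all add: proj_def)
qed

lemma proj_word_eval: "w \<in> words \<Gamma> \<Longrightarrow> proj (word_eval H x w) = word_eval G \<iota> w"
  using hom_word_eval[OF proj_hom[unfolded H_def], of w]
    word_eval_cong[of w \<Gamma> "proj \<circ> presented_gen \<Gamma> H_rels" \<iota> G] proj_x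
  by (simp add: word_class_eq_word_eval H_def x_def)

lemma proj_surj: "proj ` carrier H = carrier G"
proof
  show "proj ` carrier H \<subseteq> carrier G" using proj_hom by (auto simp: hom_def)
  show "carrier G \<subseteq> proj ` carrier H"
  proof
    fix g assume "g \<in> carrier G"
    then obtain w where w: "w \<in> words \<Gamma>" "g = word_eval G \<iota> w" by (rule G_cases)
    then have "g = proj (word_eval H x w)" by (simp add: proj_word_eval)
    moreover have "word_eval H x w \<in> carrier H"
      using group.word_eval_closed[OF group_H x_funcset w(1)] .
    ultimately show "g \<in> proj ` carrier H" by blast
  qed
qed

text \<open>The subgroup generated by \<open>H_central\<close> is already normal because its
  generators are central. Modulo it all relations of \<open>R\<close> hold: the conjugation
  relations hold in \<open>H\<close>, and the powers vanish. So
  \<open>word_cong_imp_mem_normal\<close> applies.\<close>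

lemma kernel_proj: "kernel H G proj = generate H H_central"
proof
  interpret H: group H by simp
  interpret p: group_hom H G proj by unfold_locales (rule proj_hom)
  have "H_central \<subseteq> kernel H G proj"
    by (auto simp: H_central_def kernel_def p.hom_nat_pow proj_x power_rel_G)
  then show "generate H H_central \<subseteq> kernel H G proj"
    by (rule H.generate_subgroup_incl[OF _ p.subgroup_kernel])
  show "kernel H G proj \<subseteq> generate H H_central"
  proof
    fix y assume "y \<in> kernel H G proj"
    then have y: "y \<in> carrier H" "proj y = \<one>" by (auto simp: kernel_def)
    then obtain w where w: "w \<in> words \<Gamma>" "y = word_eval H x w" by (elim H_cases)
    then have "word_eval G \<iota> w = word_eval G \<iota> []" using y proj_word_eval by simp
    then have wR: "(w, []) \<in> word_cong \<Gamma> R" using w word_eval_eq_iff[of w "[]"] by simp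
    have N: "generate H H_central \<lhd> H"
      by (rule H.generate_central_normal[OF H_central_central])
    then have S: "subgroup (generate H H_central) H" by (simp add: H.normal_inv_iff)
    have "word_class \<Gamma> H_rels w \<in> generate H H_central"
    proof (rule word_cong_imp_mem_normal[OF N[unfolded H_def] _ wR, folded H_def])
      fix u v assume uv: "(u, v) \<in> R" "u \<in> words \<Gamma>" "v \<in> words \<Gamma>"
      from uv(1) show "generate H H_central #>\<^bsub>H\<^esub> word_class \<Gamma> H_rels u =
        generate H H_central #>\<^bsub>H\<^esub> word_class \<Gamma> H_rels v"
      proof (cases rule: R_cases)
        case (conj a b c)
        then have "(u, v) \<in> H_rels" using uv by (auto simp: H_rels_def conj_part_def)
        then show ?thesis using word_class_relation uv by metis
      next
        case (power a k)
        have "word_class \<Gamma> H_rels u = x a [^]\<^bsub>H\<^esub> k"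
          using power uv H.word_eval_replicate[of x a k]
          by (simp add: word_class_eq_word_eval power_rel_def H_def x_def)
        then have "word_class \<Gamma> H_rels u \<in> H_central"
          using power uv by (auto simp: H_central_def)
        then have "generate H H_central #>\<^bsub>H\<^esub> word_class \<Gamma> H_rels u = generate H H_central"
          by (intro H.coset_join2 S generate.incl) (use uv in \<open>simp_all add: H_def\<close>)
        moreover have "generate H H_central #>\<^bsub>H\<^esub> \<one>\<^bsub>H\<^esub> = generate H H_central"
          by (intro H.coset_join2 S generate.one) simp
        moreover have "word_class \<Gamma> H_rels v = \<one>\<^bsub>H\<^esub>"
          using power by (simp add: power_rel_def H_def presented_group_one)
        ultimately show ?thesis by simp
      qed
    qed
    then show "y \<in> generate H H_central"
      using w by (simp add: word_class_eq_word_eval H_def x_def)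
  qed
qed

text \<open>A signed count of letters, with respect to classes of \<open>H\<close> rather than of
  \<open>G\<close>. Classes of \<open>G\<close> could a priori be coarser, and a count by them could
  not separate the generators that \<open>conj_class_H_iff\<close> has to compare.\<close>

definition deg :: "'a \<Rightarrow> 'a word set \<Rightarrow> int"
  where "deg c = (SOME d. d \<in> hom H integer_group \<and>
    (\<forall>a\<in>\<Gamma>. d (x a) = (if conj_class H (x a) = conj_class H (x c) then 1 else 0)))"

lemma deg_hom: "deg c \<in> hom H integer_group"
  and deg_x: "a \<in> \<Gamma> \<Longrightarrow> deg c (x a) = (if conj_class H (x a) = conj_class H (x c) then 1 else 0)"
proof -
  interpret H: group H by simp
  define h :: "'a \<Rightarrow> int"
    where "h = (\<lambda>a. if conj_class H (x a) = conj_class H (x c) then 1 else 0)"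
  have "\<exists>d. d \<in> hom H integer_group \<and> (\<forall>a\<in>\<Gamma>. d (x a) = h a)"
  proof (rule H_universal[OF group_integer_group, of h])
    fix a b c assume abc: "a \<in> \<Gamma>" "b \<in> \<Gamma>" "c \<in> \<Gamma>" "conj_rel a b c \<in> R"
    then have "conj_class H (x c) = conj_class H (x a)"
      using H.conj_class_conj_op[of "x a" "x b"] conj_rel_H by simp
    then show "conj_op integer_group (h a) (h b) = h c" by (simp add: h_def)
  qed auto
  from someI_ex[OF this] show "deg c \<in> hom H integer_group"
    "a \<in> \<Gamma> \<Longrightarrow> deg c (x a) = (if conj_class H (x a) = conj_class H (x c) then 1 else 0)"
    by (simp_all add: deg_def h_def)
qed

lemma group_hom_deg: "group_hom H integer_group (deg c)"
  by (intro group_hom.intro group_hom_axioms.intro deg_hom) simp_all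

lemma deg_mult:
  "u \<in> carrier H \<Longrightarrow> v \<in> carrier H \<Longrightarrow> deg c (u \<otimes>\<^bsub>H\<^esub> v) = deg c u + deg c v"
  using group_hom.hom_mult[OF group_hom_deg] by simp

lemma deg_inv: "u \<in> carrier H \<Longrightarrow> deg c (inv\<^bsub>H\<^esub> u) = - deg c u"
  using group_hom.hom_inv[OF group_hom_deg] by simp

lemma deg_pow: "u \<in> carrier H \<Longrightarrow> deg c (u [^]\<^bsub>H\<^esub> (k :: nat)) = int k * deg c u"
  using group_hom.hom_nat_pow[OF group_hom_deg] by simp

lemma deg_conj_op: "u \<in> carrier H \<Longrightarrow> v \<in> carrier H \<Longrightarrow> deg c (conj_op H u v) = deg c u"
  using group_hom.hom_conj_op[OF group_hom_deg] by simp

lemma proj_conj_class: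
  assumes "a \<in> \<Gamma>" "b \<in> \<Gamma>" "conj_class H (x a) = conj_class H (x b)"
  shows "conj_class G (\<iota> a) = conj_class G (\<iota> b)"
proof -
  interpret H: group H by simp
  interpret p: group_hom H G proj by unfold_locales (rule proj_hom)
  have "x a \<in> conj_class H (x b)" using assms H.mem_conj_class_self by force
  then obtain u where u: "u \<in> carrier H" "x a = conj_op H (x b) u" by (auto simp: conj_class_def)
  then have "\<iota> a = conj_op G (\<iota> b) (proj u)"
    using p.hom_conj_op[of "x b" u] assms by (simp add: proj_x flip: u(2))
  then show ?thesis using conj_class_conj_op \<iota>_closed assms u by simp
qed

text \<open>
  The number \<open>d\<close> is the exponent of the power relation in the class of \<open>c\<close>, or 0 if there is none.
\<close>

lemma deg_kernel_dvd:
  assumes c: "c \<in> \<Gamma>"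
  obtains d :: nat where "d \<noteq> 1" "\<And>y. y \<in> kernel H G proj \<Longrightarrow> int d dvd deg c y"
    "d \<noteq> 0 \<Longrightarrow> \<exists>a\<in>\<Gamma>. power_rel a d \<in> R \<and> conj_class H (x a) = conj_class H (x c)"
proof -
  interpret H: group H by simp
  have sub: "H_central \<subseteq> carrier H" using H_central_central H.group_center_closed by blast
  \<comment> \<open>At \<open>c\<close>, a generator of the kernel has degree \<open>k\<close> or 0,
    and divisibility by \<open>d\<close> passes to products and inverses.\<close>
  have dvd: "d dvd deg c y" if y: "y \<in> kernel H G proj"
    and d: "\<And>a k. a \<in> \<Gamma> \<Longrightarrow> power_rel a k \<in> R \<Longrightarrow> conj_class H (x a) = conj_class H (x c) \<Longrightarrow> d dvd int k"
    for d y
  proof -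
    have gens: "d dvd deg c z" if "z \<in> H_central" for z
      using that d by (auto simp: H_central_def deg_pow deg_x)
    from y have "y \<in> generate H H_central" by (simp add: kernel_proj)
    then show ?thesis
    proof (induction rule: generate.induct)
      case one
      then show ?case using group_hom.hom_one[OF group_hom_deg] by simp
    next
      case (incl z)
      then show ?case by (rule gens)
    next
      case (inv z)
      then show ?case using gens sub by (simp add: deg_inv subset_iff)
    next
      case (eng z z')
      then show ?case using H.generate_in_carrier[OF sub] by (simp add: deg_mult)
    qed
  qed
  show thesis
  proof (cases "\<exists>a k. power_rel a k \<in> R \<and> conj_class H (x a) = conj_class H (x c)")
    case True
    then obtain a k where ak: "power_rel a k \<in> R" "conj_class H (x a) = conj_class H (x c)" by blast
    show thesis
    proof (rule that[of k])
      show "k \<noteq> 1" using power_relD(2)[OF ak(1)] by simp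
      show "\<exists>a\<in>\<Gamma>. power_rel a k \<in> R \<and> conj_class H (x a) = conj_class H (x c)"
        using ak power_relD(1)[OF ak(1)] by blast
      fix y assume "y \<in> kernel H G proj"
      then show "int k dvd deg c y"
      proof (rule dvd)
        fix b l assume bl: "b \<in> \<Gamma>" "power_rel b l \<in> R" "conj_class H (x b) = conj_class H (x c)"
        \<comment> \<open>A second power relation in the same class of \<open>H\<close> would lie in
          the same class of \<open>G\<close>, so it is the relation for \<open>a\<close>.\<close>
        then have "conj_class G (\<iota> a) = conj_class G (\<iota> b)"
          using ak power_relD(1)[OF ak(1)] by (intro proj_conj_class) auto
        then show "int k dvd int l" using power_rel_unique[OF ak(1) bl(2)] by simp
      qed
    qed
  next
    case False
    \<comment> \<open>Without a power relation in the class every degree on the kernel is zero,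
      which is divisibility by 0.\<close>
    show thesis
    proof (rule that[of 0])
      show "int 0 dvd deg c y" if "y \<in> kernel H G proj" for y
        by (rule dvd[OF that]) (use False in blast)
    qed auto
  qed
qed

text \<open>Makes degrees computable from conjugacy in \<open>G\<close>. Projection gives one
  direction; the other rests on \<open>deg_kernel_dvd\<close>, by which no kernel element has degree
  1 at a generator.\<close>

lemma conj_class_H_iff:
  assumes a: "a \<in> \<Gamma>" and b: "b \<in> \<Gamma>"
  shows "conj_class H (x a) = conj_class H (x b) \<longleftrightarrow> conj_class G (\<iota> a) = conj_class G (\<iota> b)"
proof
  assume "conj_class G (\<iota> a) = conj_class G (\<iota> b)"
  then have "\<iota> b \<in> conj_class G (\<iota> a)" using mem_conj_class_self \<iota>_closed b by simp
  then obtain u where u: "u \<in> carrier H" "\<iota> b = conj_op G (\<iota> a) (proj u)"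
    unfolding conj_class_def proj_surj[symmetric] by blast
  interpret H: group H by simp
  interpret p: group_hom H G proj by unfold_locales (rule proj_hom)
  \<comment> \<open>Both factors lie over \<open>\<iota> b\<close>, so \<open>y\<close> measures by
    how much the conjugation in \<open>G\<close> fails to lift.\<close>
  define y where "y = conj_op H (x a) u \<otimes>\<^bsub>H\<^esub> inv\<^bsub>H\<^esub> x b"
  have y: "y \<in> kernel H G proj"
    using a b u \<iota>_closed[OF b] by (simp add: kernel_def y_def p.hom_conj_op proj_x flip: u(2))
  have deg_y: "deg a y = 1 - deg a (x b)"
    using a b u by (simp add: y_def deg_mult deg_inv deg_conj_op deg_x)
  obtain d :: nat where d: "d \<noteq> 1" "\<And>y. y \<in> kernel H G proj \<Longrightarrow> int d dvd deg a y"
    using deg_kernel_dvd[OF a] by metis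
  show "conj_class H (x a) = conj_class H (x b)"
  proof (rule ccontr)
    assume "conj_class H (x a) \<noteq> conj_class H (x b)"
    then have "deg a y = 1" using deg_y deg_x[OF b, of a] by simp
    then show False using d(2)[OF y] d(1) by simp
  qed
qed (rule proj_conj_class[OF a b])

text \<open>The power of \<open>x c\<close> with exponent \<open>ord (\<iota> c)\<close> lies in the
  kernel and has nonzero degree at \<open>c\<close>. Hence the divisor from
  \<open>deg_kernel_dvd\<close> is not 0, and it comes from a power relation in the class of
  \<open>c\<close>.\<close>

lemma finite_order_power_rel:
  assumes c: "c \<in> \<Gamma>" and ord: "ord (\<iota> c) \<noteq> 0"
  shows "\<exists>a\<in>\<Gamma>. \<exists>k. power_rel a k \<in> R \<and> conj_class G (\<iota> a) = conj_class G (\<iota> c)"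
proof -
  interpret H: group H by simp
  interpret p: group_hom H G proj by unfold_locales (rule proj_hom)
  have "x c [^]\<^bsub>H\<^esub> ord (\<iota> c) \<in> kernel H G proj"
    using c \<iota>_closed[OF c] by (simp add: kernel_def p.hom_nat_pow proj_x)
  moreover have "deg c (x c [^]\<^bsub>H\<^esub> ord (\<iota> c)) = int (ord (\<iota> c))"
    using c by (simp add: deg_pow deg_x)
  moreover obtain d :: nat where d: "\<And>y. y \<in> kernel H G proj \<Longrightarrow> int d dvd deg c y"
    "d \<noteq> 0 \<Longrightarrow> \<exists>a\<in>\<Gamma>. power_rel a d \<in> R \<and> conj_class H (x a) = conj_class H (x c)"
    using deg_kernel_dvd[OF c] by metis
  ultimately have "d \<noteq> 0" using ord by fastforce
  with d(2) show ?thesis using conj_class_H_iff c by blast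
qed

text \<open>Apply \<open>central_family_free\<close> to the family of all power relations. Distinct
  ones belong to distinct classes, so the degree at one generator vanishes on the powers of the
  others.\<close>

lemma kernel_proj_deg_zero:
  assumes y: "y \<in> kernel H G proj" and deg: "\<And>c. c \<in> \<Gamma> \<Longrightarrow> deg c y = 0"
  shows "y = \<one>\<^bsub>H\<^esub>"
proof -
  interpret H: group H by simp
  define P where "P = {(a, k). power_rel a k \<in> R}"
  define z where "z = (\<lambda>(a, k). x a [^]\<^bsub>H\<^esub> (k :: nat))"
  have zP: "z ` P = H_central"
    using power_relD by (auto simp: z_def P_def H_central_def)
  show ?thesis
  proof (rule H.central_family_free[of P z "\<lambda>(a, k). deg a"])
    show "z r \<in> group_center H" if "r \<in> P" for r
      using that zP H_central_central by blast
    show "(case r of (a, k) \<Rightarrow> deg a) \<in> hom H integer_group" for r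
      by (cases r) (simp add: deg_hom)
    show "(case r of (a, k) \<Rightarrow> deg a) (z r) \<noteq> 0" if "r \<in> P" for r
    proof -
      obtain a k where [simp]: "r = (a, k)" by (cases r)
      have "a \<in> \<Gamma>" "2 \<le> k" using that power_relD[of a k] by (auto simp: P_def)
      then show ?thesis by (simp add: z_def deg_pow deg_x)
    qed
    show "(case r of (a, k) \<Rightarrow> deg a) (z s) = 0" if rs: "r \<in> P" "s \<in> P" "r \<noteq> s" for r s
    proof -
      obtain a k b l where [simp]: "r = (a, k)" "s = (b, l)" by (cases r, cases s)
      have R: "power_rel a k \<in> R" "power_rel b l \<in> R" using rs by (auto simp: P_def)
      then have \<Gamma>: "a \<in> \<Gamma>" "b \<in> \<Gamma>" using power_relD by auto
      then have "conj_class H (x b) \<noteq> conj_class H (x a)"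
        using power_rel_unique[OF R] rs conj_class_H_iff by auto
      then show ?thesis using \<Gamma> by (simp add: z_def deg_pow deg_x)
    qed
    fix i assume free: "\<And>y. y \<in> generate H (z ` P) \<Longrightarrow>
      (\<And>r. r \<in> P \<Longrightarrow> (case r of (a, k) \<Rightarrow> deg a) y = 0) \<Longrightarrow> y = \<one>\<^bsub>H\<^esub>"
    show "y = \<one>\<^bsub>H\<^esub>"
    proof (rule free)
      show "y \<in> generate H (z ` P)" using y by (simp add: zP kernel_proj)
      show "(case r of (a, k) \<Rightarrow> deg a) y = 0" if "r \<in> P" for r
        using that deg power_relD(1) by (auto simp: P_def)
    qed
  qed
qed

lemma conj_op_x_eqI:
  assumes a: "a \<in> \<Gamma>" "u \<in> carrier H" and b: "b \<in> \<Gamma>" "v \<in> carrier H"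
    and eq: "proj (conj_op H (x a) u) = proj (conj_op H (x b) v)"
  shows "conj_op H (x a) u = conj_op H (x b) v"
proof -
  interpret H: group H by simp
  interpret p: group_hom H G proj by unfold_locales (rule proj_hom)
  have "conj_op G (\<iota> a) (proj u) = conj_op G (\<iota> b) (proj v)"
    using eq a b by (simp add: p.hom_conj_op proj_x)
  then have "conj_class G (\<iota> a) = conj_class G (\<iota> b)"
    using conj_class_conj_op[of "\<iota> a" "proj u"] conj_class_conj_op[of "\<iota> b" "proj v"] a b \<iota>_closed
    by simp
  \<comment> \<open>Degrees only depend on classes of \<open>H\<close>, so the conjugacy found in
    \<open>G\<close> must be pulled back before they can be equated.\<close>
  then have "conj_class H (x a) = conj_class H (x b)" using conj_class_H_iff a b by simp
  then have "deg c (conj_op H (x a) u) = deg c (conj_op H (x b) v)" for c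
    using a b by (simp add: deg_conj_op deg_x)
  moreover define y where "y = conj_op H (x a) u \<otimes>\<^bsub>H\<^esub> inv\<^bsub>H\<^esub> conj_op H (x b) v"
  ultimately have "deg c y = 0" for c
    using a b by (simp add: deg_mult deg_inv)
  moreover have "y \<in> kernel H G proj"
    using a b eq by (simp add: kernel_def y_def)
  ultimately have "y = \<one>\<^bsub>H\<^esub>" by (intro kernel_proj_deg_zero)
  then show ?thesis
    using a b H.inv_solve_right'[of "\<one>\<^bsub>H\<^esub>" "conj_op H (x a) u" "conj_op H (x b) v"]
    by (simp add: y_def)
qed

section \<open>Comparison with the associated group\<close>

sublocale D: dehn_quandle_group G "\<iota> ` \<Gamma>"
  by unfold_locales (use \<iota>_closed in blast)

lemma \<iota>_in_quandle: "a \<in> \<Gamma> \<Longrightarrow> \<iota> a \<in> D.Q"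
  by (simp add: D.gen_in_quandle)

text \<open>With \<open>kernel_counit_central\<close> this makes the powers central in the
  associated group, as a map out of \<open>H\<close> requires.\<close>

lemma power_e_kernel:
  assumes "a \<in> \<Gamma>" "power_rel a k \<in> R"
  shows "D.e (\<iota> a) [^]\<^bsub>D.GD\<^esub> k \<in> kernel D.GD G D.counit"
proof -
  interpret GD: group D.GD by simp
  interpret g: group_hom D.GD G D.counit by unfold_locales (rule D.counit_hom)
  show ?thesis
    using assms \<iota>_in_quandle
    by (simp add: kernel_def g.hom_nat_pow D.counit_e power_rel_G)
qed

definition to_GD :: "'a word set \<Rightarrow> 'g word set"
  where "to_GD = (SOME \<phi>. \<phi> \<in> hom H D.GD \<and> (\<forall>a\<in>\<Gamma>. \<phi> (x a) = D.e (\<iota> a)))"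

lemma to_GD_hom: "to_GD \<in> hom H D.GD" and to_GD_x: "a \<in> \<Gamma> \<Longrightarrow> to_GD (x a) = D.e (\<iota> a)"
proof -
  have "\<exists>\<phi>. \<phi> \<in> hom H D.GD \<and> (\<forall>a\<in>\<Gamma>. \<phi> (x a) = D.e (\<iota> a))"
  proof (rule H_universal[OF D.group_GD, of "\<lambda>a. D.e (\<iota> a)"])
    show "(\<lambda>a. D.e (\<iota> a)) \<in> \<Gamma> \<rightarrow> carrier D.GD" by (simp add: \<iota>_in_quandle)
    show "conj_op D.GD (D.e (\<iota> a)) (D.e (\<iota> b)) = D.e (\<iota> c)"
      if "a \<in> \<Gamma>" "b \<in> \<Gamma>" "c \<in> \<Gamma>" "conj_rel a b c \<in> R" for a b c
      using that by (simp add: D.conj_e \<iota>_in_quandle conj_rel_G)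
    show "D.e (\<iota> a) [^]\<^bsub>D.GD\<^esub> k \<in> group_center D.GD"
      if "a \<in> \<Gamma>" "power_rel a k \<in> R" for a k
      using power_e_kernel[OF that] D.kernel_counit_central by blast
  qed blast
  from someI_ex[OF this] show "to_GD \<in> hom H D.GD" "a \<in> \<Gamma> \<Longrightarrow> to_GD (x a) = D.e (\<iota> a)"
    by (simp_all add: to_GD_def)
qed

lemma counit_to_GD: "y \<in> carrier H \<Longrightarrow> D.counit (to_GD y) = proj y"
  using H_hom_eqI[OF Group.hom_compose[OF to_GD_hom D.counit_hom] proj_hom is_group, of y]
  by (simp add: to_GD_x proj_x D.counit_e \<iota>_in_quandle)

text \<open>
  An element of the Dehn quandle has a unique lift to \<open>H\<close> that is conjugate to a generator.
\<close>

definition quandle_lift :: "'g \<Rightarrow> 'a word set"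
  where "quandle_lift q =
    (SOME y. proj y = q \<and> (\<exists>a\<in>\<Gamma>. \<exists>u\<in>carrier H. y = conj_op H (x a) u))"

lemma quandle_lift:
  assumes q: "q \<in> D.Q"
  shows "proj (quandle_lift q) = q \<and>
    (\<exists>a\<in>\<Gamma>. \<exists>u\<in>carrier H. quandle_lift q = conj_op H (x a) u)"
proof -
  interpret H: group H by simp
  interpret p: group_hom H G proj by unfold_locales (rule proj_hom)
  obtain a g where a: "a \<in> \<Gamma>" "g \<in> carrier G" "q = conj_op G (\<iota> a) g"
    using q by (auto simp: dehn_quandle_def conj_class_def)
  then obtain u where u: "u \<in> carrier H" "g = proj u" using proj_surj by blast
  have "proj (conj_op H (x a) u) = q"
    using a u by (simp add: p.hom_conj_op proj_x)
  then have "\<exists>y. proj y = q \<and> (\<exists>a\<in>\<Gamma>. \<exists>u\<in>carrier H. y = conj_op H (x a) u)"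
    using a u by blast
  from someI_ex[OF this] show ?thesis unfolding quandle_lift_def .
qed

text \<open>By \<open>conj_op_x_eqI\<close> the choice in \<open>quandle_lift\<close> is
  forced.\<close>

lemma quandle_lift_eqI:
  assumes "a \<in> \<Gamma>" "u \<in> carrier H" "proj (conj_op H (x a) u) \<in> D.Q"
  shows "quandle_lift (proj (conj_op H (x a) u)) = conj_op H (x a) u"
proof -
  obtain b v where "b \<in> \<Gamma>" "v \<in> carrier H"
      "quandle_lift (proj (conj_op H (x a) u)) = conj_op H (x b) v"
      "proj (conj_op H (x b) v) = proj (conj_op H (x a) u)"
    using quandle_lift[OF assms(3)] by metis
  then show ?thesis using conj_op_x_eqI assms by metis
qed

lemma quandle_lift_closed: "q \<in> D.Q \<Longrightarrow> quandle_lift q \<in> carrier H"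
  using quandle_lift[of q] group.conj_op_closed[OF group_H] x_closed by metis

text \<open>The left side is again a conjugate of a generator and has the right image in
  \<open>G\<close>, so uniqueness of lifts identifies it. Thus \<open>quandle_lift\<close> is a
  quandle homomorphism, to which \<open>D.GD_universal\<close> applies.\<close>

lemma quandle_lift_conj:
  assumes q: "q \<in> D.Q" and r: "r \<in> D.Q"
  shows "conj_op H (quandle_lift q) (quandle_lift r) = quandle_lift (conj_op G q r)"
proof -
  interpret H: group H by simp
  interpret p: group_hom H G proj by unfold_locales (rule proj_hom)
  obtain a u where a: "a \<in> \<Gamma>" "u \<in> carrier H" "quandle_lift q = conj_op H (x a) u"
    using quandle_lift[OF q] by blast
  have r': "quandle_lift r \<in> carrier H" using quandle_lift_closed[OF r] .
  have eq: "conj_op H (quandle_lift q) (quandle_lift r) = conj_op H (x a) (u \<otimes>\<^bsub>H\<^esub> quandle_lift r)"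
    using a r' by (simp add: H.conj_op_mult)
  have "proj (conj_op H (x a) (u \<otimes>\<^bsub>H\<^esub> quandle_lift r)) = conj_op G q r"
    unfolding eq[symmetric]
    using quandle_lift[OF q] quandle_lift[OF r] quandle_lift_closed[OF q] r'
    by (simp add: p.hom_conj_op)
  then show ?thesis
    using quandle_lift_eqI[of a "u \<otimes>\<^bsub>H\<^esub> quandle_lift r"] a r' D.quandle_conj[OF q D.quandle_closed[OF r]]
    unfolding eq by simp
qed

text \<open>By \<open>D.conj_e_counit\<close>, conjugating a generator by \<open>to_GD u\<close>
  depends only on the image of \<open>u\<close> in \<open>G\<close>.\<close>

lemma to_GD_quandle_lift:
  assumes q: "q \<in> D.Q"
  shows "to_GD (quandle_lift q) = D.e q"
proof -
  interpret H: group H by simp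
  interpret GD: group D.GD by simp
  interpret p: group_hom H G proj by unfold_locales (rule proj_hom)
  interpret F: group_hom H D.GD to_GD by unfold_locales (rule to_GD_hom)
  obtain a u where a: "a \<in> \<Gamma>" "u \<in> carrier H" "quandle_lift q = conj_op H (x a) u"
    using quandle_lift[OF q] by blast
  have "to_GD (quandle_lift q) = conj_op D.GD (D.e (\<iota> a)) (to_GD u)"
    using a by (simp add: F.hom_conj_op to_GD_x)
  also have "\<dots> = D.e (conj_op G (\<iota> a) (proj u))"
    using a by (simp add: D.conj_e_counit \<iota>_in_quandle counit_to_GD)
  also have "conj_op G (\<iota> a) (proj u) = proj (quandle_lift q)"
    using a by (simp add: p.hom_conj_op proj_x)
  finally show ?thesis using quandle_lift[OF q] by simp
qed

lemma to_GD_iso: "to_GD \<in> iso H D.GD"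
proof -
  interpret H: group H by simp
  interpret GD: group D.GD by simp
  obtain s where s: "s \<in> hom D.GD H" "\<And>q. q \<in> D.Q \<Longrightarrow> s (D.e q) = quandle_lift q"
    by (rule D.GD_universal[OF group_H, of quandle_lift])
      (auto simp: quandle_lift_closed quandle_lift_conj)
  have "to_GD (s y) = y" if "y \<in> carrier D.GD" for y
    using D.GD_hom_eqI[OF Group.hom_compose[OF s(1) to_GD_hom], of "\<lambda>y. y" y] that
    by (simp add: s(2) to_GD_quandle_lift hom_def)
  moreover have "s (to_GD y) = y" if "y \<in> carrier H" for y
  proof -
    \<comment> \<open>Since \<open>x a\<close> is its own conjugate by the identity, it is the lift
      of its image. In particular symbols that denote the same element of \<open>G\<close> already
      agree in \<open>H\<close>.\<close>
    have "quandle_lift (\<iota> a) = x a" if "a \<in> \<Gamma>" for a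
      using quandle_lift_eqI[of a "\<one>\<^bsub>H\<^esub>"] that by (simp add: proj_x \<iota>_in_quandle)
    then show ?thesis
      using H_hom_eqI[OF Group.hom_compose[OF to_GD_hom s(1)], of "\<lambda>y. y" y] that
      by (simp add: s(2) to_GD_x \<iota>_in_quandle hom_def)
  qed
  ultimately have "bij_betw to_GD (carrier H) (carrier D.GD)"
    using to_GD_hom s(1) by (intro bij_betw_byWitness[where f' = s]) (auto simp: hom_def)
  then show ?thesis using to_GD_hom by (simp add: iso_def)
qed

text \<open>The relations that \<open>H\<close> has beyond those of the Artin-type lift are
  commutations, and modulo the normal closure each of them holds because the corresponding
  commutator lies in it. So \<open>word_cong_imp_mem_normal\<close> bounds the kernel; the other
  inclusion is centrality of the powers in \<open>H\<close>.\<close>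

lemma artin_to_H:
  obtains p where "p \<in> epi (artin_lift \<Gamma> R) H" "\<And>a. a \<in> \<Gamma> \<Longrightarrow> p (artin_gen \<Gamma> R a) = x a"
    "kernel (artin_lift \<Gamma> R) H p = normal_closure (artin_lift \<Gamma> R)
      {commutator (artin_lift \<Gamma> R) (artin_gen \<Gamma> R a [^]\<^bsub>artin_lift \<Gamma> R\<^esub> k) y | a k y.
        a \<in> \<Gamma> \<and> power_rel a k \<in> R \<and> y \<in> carrier (artin_lift \<Gamma> R)}"
proof -
  let ?GA = "artin_lift \<Gamma> R" and ?t = "artin_gen \<Gamma> R"
  let ?C = "{commutator ?GA (?t a [^]\<^bsub>?GA\<^esub> k) y | a k y.
    a \<in> \<Gamma> \<and> power_rel a k \<in> R \<and> y \<in> carrier ?GA}"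
  interpret H: group H by simp
  interpret GA: group ?GA by (simp add: artin_lift_def)
  have t_closed: "?t a \<in> carrier ?GA" if "a \<in> \<Gamma>" for a
    using that by (simp add: artin_lift_def artin_gen_def)
  obtain p where p: "p \<in> hom ?GA H" "\<And>a. a \<in> \<Gamma> \<Longrightarrow> p (?t a) = x a"
    by (rule artin_universal[OF group_H x_funcset conj_rel_H]) blast+
  interpret p: group_hom ?GA H p by unfold_locales (rule p)
  \<comment> \<open>On classes of words the map merely coarsens the congruence, so a kernel element
    is represented by a word congruent to \<open>[]\<close> under \<open>H_rels\<close>.\<close>
  have p_class: "p (word_class \<Gamma> (conj_part R) w) = word_class \<Gamma> H_rels w" if "w \<in> words \<Gamma>" for w
    using H.hom_word_eval[OF p(1)[unfolded artin_lift_def] that]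
      word_eval_cong[OF that, of "p \<circ> presented_gen \<Gamma> (conj_part R)" x H] p(2)
    by (simp add: artin_gen_def H_def x_def word_class_eq_word_eval[OF that, of H_rels])
  have class_closed: "word_class \<Gamma> (conj_part R) w \<in> carrier ?GA" if "w \<in> words \<Gamma>" for w
    using that by (simp add: artin_lift_def)
  have "carrier H \<subseteq> p ` carrier ?GA"
  proof
    fix y assume "y \<in> carrier H"
    then obtain w where "w \<in> words \<Gamma>" "y = word_class \<Gamma> H_rels w"
      unfolding H_def by (rule presented_group_cases)
    then show "y \<in> p ` carrier ?GA" using p_class class_closed by (metis image_eqI)
  qed
  then have epi: "p \<in> epi ?GA H" using p(1) p.hom_closed by (auto simp: epi_def)
  have C: "?C \<subseteq> carrier ?GA"
    using t_closed by (auto simp: commutator_def)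
  have N: "normal_closure ?GA ?C \<lhd> ?GA" by (rule GA.normal_closure_normal[OF C])
  have "kernel ?GA H p = normal_closure ?GA ?C"
  proof
    show "normal_closure ?GA ?C \<subseteq> kernel ?GA H p"
    proof (rule GA.normal_closure_minimal[OF p.normal_kernel], rule subsetI)
      fix c assume c: "c \<in> ?C"
      then obtain a k y where c': "c = commutator ?GA (?t a [^]\<^bsub>?GA\<^esub> k) y"
        "a \<in> \<Gamma>" "power_rel a k \<in> R" "y \<in> carrier ?GA" by blast
      have "p c = commutator H (x a [^]\<^bsub>H\<^esub> k) (p y)"
        using c' t_closed by (simp add: p.hom_commutator p.hom_nat_pow p(2))
      also have "\<dots> = \<one>\<^bsub>H\<^esub>"
        using c' H.group_center_commute[OF power_central_H, of a k "p y"]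
        by (subst H.commutator_eq_one_iff) auto
      finally show "c \<in> kernel ?GA H p" using subsetD[OF C c] by (simp add: kernel_def)
    qed
    show "kernel ?GA H p \<subseteq> normal_closure ?GA ?C"
    proof
      fix y assume "y \<in> kernel ?GA H p"
      then have y: "y \<in> carrier ?GA" "p y = \<one>\<^bsub>H\<^esub>" by (auto simp: kernel_def)
      from y(1) obtain w where w: "w \<in> words \<Gamma>" "y = word_class \<Gamma> (conj_part R) w"
        unfolding artin_lift_def by (rule presented_group_cases)
      then have "word_class \<Gamma> H_rels w = word_class \<Gamma> H_rels []"
        using p_class y by (simp add: H_def presented_group_one)
      then have "(w, []) \<in> word_cong \<Gamma> H_rels"
        using word_class_eq_iff[of w \<Gamma> "[]" H_rels] w(1) by simp
      then have "word_class \<Gamma> (conj_part R) w \<in> normal_closure ?GA ?C"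
      proof (rule word_cong_imp_mem_normal[OF N[unfolded artin_lift_def], folded artin_lift_def, rotated])
        fix u v assume uv: "(u, v) \<in> H_rels" "u \<in> words \<Gamma>" "v \<in> words \<Gamma>"
        show "normal_closure ?GA ?C #>\<^bsub>?GA\<^esub> word_class \<Gamma> (conj_part R) u =
          normal_closure ?GA ?C #>\<^bsub>?GA\<^esub> word_class \<Gamma> (conj_part R) v"
        proof (cases "(u, v) \<in> conj_part R")
          case True
          then have "word_class \<Gamma> (conj_part R) u = word_class \<Gamma> (conj_part R) v"
            using uv by (intro word_class_relation)
          then show ?thesis by simp
        next
          case False
          then have "(u, v) \<in> central_rels" using uv by (simp add: H_rels_def)
          then obtain a k w where w: "u = replicate k (a, True) @ w" "v = w @ replicate k (a, True)"
            "a \<in> \<Gamma>" "power_rel a k \<in> R" "w \<in> words \<Gamma>"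
            by (auto simp: central_rels_def)
          let ?w = "word_class \<Gamma> (conj_part R) w"
          have "word_class \<Gamma> (conj_part R) (replicate k (a, True)) = ?t a [^]\<^bsub>?GA\<^esub> k"
            using w GA.word_eval_replicate[of ?t a k] t_closed
            by (simp add: word_class_eq_word_eval artin_lift_def artin_gen_def[abs_def])
          then have uv': "word_class \<Gamma> (conj_part R) u = ?t a [^]\<^bsub>?GA\<^esub> k \<otimes>\<^bsub>?GA\<^esub> ?w"
            "word_class \<Gamma> (conj_part R) v = ?w \<otimes>\<^bsub>?GA\<^esub> ?t a [^]\<^bsub>?GA\<^esub> k"
            using w presented_group_mult[of "replicate k (a, True)" \<Gamma> w "conj_part R"]
              presented_group_mult[of w \<Gamma> "replicate k (a, True)" "conj_part R"]
            by (simp_all add: artin_lift_def)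
          have "commutator ?GA (?t a [^]\<^bsub>?GA\<^esub> k) ?w \<in> ?C"
            using w class_closed by blast
          then have "commutator ?GA (?t a [^]\<^bsub>?GA\<^esub> k) ?w \<in> normal_closure ?GA ?C"
            by (rule subsetD[OF GA.subset_normal_closure])
          then show ?thesis
            unfolding uv' using w t_closed class_closed
            by (intro GA.rcos_mult_commute_of_commutator[OF N]) auto
        qed
      qed
      then show "y \<in> normal_closure ?GA ?C" using w by simp
    qed
  qed
  then show thesis using that[of p] epi p(2) by blast
qed

section \<open>The basis of the kernel, indexed by classes of finite order generators\<close>

lemma power_rel_fin_gen_class:
  assumes "power_rel a k \<in> R"
  shows "conj_class G (\<iota> a) \<in> fin_gen_classes G (\<iota> ` \<Gamma>)"
proof -
  have a: "a \<in> \<Gamma>" "2 \<le> k" using power_relD[OF assms] by auto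
  have "ord (\<iota> a) dvd k"
    using pow_eq_id[OF \<iota>_closed[OF a(1)], of k] power_rel_G[OF assms] by simp
  \<comment> \<open>The value 0 stands for infinite order, and 0 does not divide the positive
    exponent \<open>k\<close>.\<close>
  then have "ord (\<iota> a) \<noteq> 0" using a by (auto intro!: Nat.gr0I)
  then show ?thesis
    using a \<iota>_closed mem_conj_class_self unfolding fin_gen_classes_def conj_classes_def by blast
qed

lemma fin_gen_class_power_rel:
  assumes "K \<in> fin_gen_classes G (\<iota> ` \<Gamma>)"
  obtains a k where "power_rel a k \<in> R" "conj_class G (\<iota> a) = K"
proof -
  obtain g c where K: "g \<in> carrier G" "K = conj_class G g" "c \<in> \<Gamma>" "\<iota> c \<in> K" "ord (\<iota> c) \<noteq> 0"
    using assms by (auto simp: fin_gen_classes_def conj_classes_def)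
  then have "conj_class G (\<iota> c) = K" using conj_class_eq by simp
  then show thesis using finite_order_power_rel[OF K(3,5)] that by metis
qed

text \<open>Here \<open>central_family_free\<close> is indexed by classes instead of relations. Each
  class contains a generator with a power relation, chosen by \<open>r\<close>; by
  \<open>power_rel_unique\<close> the choices exhaust \<open>H_central\<close>.\<close>

lemma free_Abelian_kernel:
  obtains i where "i \<in> mon (free_Abelian_group (fin_gen_classes G (\<iota> ` \<Gamma>))) H"
    "i ` carrier (free_Abelian_group (fin_gen_classes G (\<iota> ` \<Gamma>))) = generate H H_central"
proof -
  interpret H: group H by simp
  let ?F = "fin_gen_classes G (\<iota> ` \<Gamma>)"
  have "\<exists>r. power_rel (fst r) (snd r) \<in> R \<and> conj_class G (\<iota> (fst r)) = K" if K: "K \<in> ?F" for K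
    using K by (rule fin_gen_class_power_rel) (metis fst_conv snd_conv)
  then obtain r where r: "\<And>K. K \<in> ?F \<Longrightarrow> power_rel (fst (r K)) (snd (r K)) \<in> R"
    "\<And>K. K \<in> ?F \<Longrightarrow> conj_class G (\<iota> (fst (r K))) = K"
    by metis
  define z where "z K = x (fst (r K)) [^]\<^bsub>H\<^esub> snd (r K)" for K
  have r_\<Gamma>: "fst (r K) \<in> \<Gamma>" "2 \<le> snd (r K)" if "K \<in> ?F" for K
    using power_relD r(1)[OF that] by auto
  have "z K \<in> H_central" if "K \<in> ?F" for K
    using r(1)[OF that] r_\<Gamma>[OF that] by (auto simp: z_def H_central_def)
  moreover have "y \<in> z ` ?F" if "y \<in> H_central" for y
  proof -
    obtain a k where a: "a \<in> \<Gamma>" "power_rel a k \<in> R" "y = x a [^]\<^bsub>H\<^esub> k"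
      using \<open>y \<in> H_central\<close> by (auto simp: H_central_def)
    define K where "K = conj_class G (\<iota> a)"
    have K: "K \<in> ?F" using power_rel_fin_gen_class[OF a(2)] by (simp add: K_def)
    then have "fst (r K) = a \<and> snd (r K) = k"
      using r[OF K] a by (intro power_rel_unique) (auto simp: K_def)
    then have "y = z K" using a by (simp add: z_def)
    then show ?thesis using K by blast
  qed
  ultimately have zF: "z ` ?F = H_central" by blast
  show thesis
  proof (rule H.central_family_free[of ?F z "\<lambda>K. deg (fst (r K))"])
    show "z K \<in> group_center H" if "K \<in> ?F" for K
      using that zF H_central_central by blast
    show "deg (fst (r K)) \<in> hom H integer_group" for K by (rule deg_hom)
    show "deg (fst (r K)) (z K) \<noteq> 0" if "K \<in> ?F" for K
      using r_\<Gamma>[OF that] by (simp add: z_def deg_pow deg_x)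
    show "deg (fst (r K)) (z L) = 0" if "K \<in> ?F" "L \<in> ?F" "K \<noteq> L" for K L
      using r_\<Gamma>[OF that(1)] r_\<Gamma>[OF that(2)] r(2)[OF that(1)] r(2)[OF that(2)] that(3)
      by (simp add: z_def deg_pow deg_x conj_class_H_iff)
    fix i assume "i \<in> mon (free_Abelian_group ?F) H"
      "i ` carrier (free_Abelian_group ?F) = generate H (z ` ?F)"
    then show thesis using that zF by simp
  qed
qed

end

text \<open>The statements are known for \<open>H\<close> and are transported along the isomorphism
  \<open>to_GD\<close>, which satisfies \<open>D.counit (to_GD y) = proj y\<close> on the carrier of
  \<open>H\<close>. The map \<open>f\<close> is the quotient map onto \<open>H\<close> followed by
  \<open>to_GD\<close>, and \<open>g\<close> is \<open>D.counit\<close>.\<close>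

theorem theorem4:
  fixes G :: "('g, 'm) monoid_scheme"
    and \<Gamma> :: "'a set"
    and R :: "('a word \<times> 'a word) set"
    and \<iota> :: "'a \<Rightarrow> 'g"
  assumes "Cbar_presentation G \<Gamma> R \<iota>"
  shows "let GA = artin_lift \<Gamma> R;
             GD = dehn_lift G (\<iota> ` \<Gamma>);
             e = (\<lambda>a. dehn_gen G (\<iota> ` \<Gamma>) (\<iota> a));
             Z = {e a [^]\<^bsub>GD\<^esub> k | a k. a \<in> \<Gamma> \<and> power_rel a k \<in> R}
         in \<exists>f g.
           f \<in> epi GA GD \<and> g \<in> epi GD G \<and>
           (\<forall>a\<in>\<Gamma>. f (artin_gen \<Gamma> R a) = e a \<and> g (e a) = \<iota> a) \<and>
           kernel GA GD f =
             normal_closure GA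
               {commutator GA (artin_gen \<Gamma> R a [^]\<^bsub>GA\<^esub> k) x | a k x.
                 a \<in> \<Gamma> \<and> power_rel a k \<in> R \<and> x \<in> carrier GA} \<and>
           Z \<subseteq> group_center GD \<and>
           kernel GD G g = generate GD Z \<and>
           (\<exists>i. central_extension (free_Abelian_group (fin_gen_classes G (\<iota> ` \<Gamma>))) i GD g G)"
proof -
  have "group G" using assms by (simp add: Cbar_presentation_def is_presentation_def)
  then interpret Cbar G \<Gamma> R \<iota>
    by (intro Cbar.intro Cbar_axioms.intro assms)
  let ?GA = "artin_lift \<Gamma> R" and ?GD = "dehn_lift G (\<iota> ` \<Gamma>)"
  let ?Z = "{D.e (\<iota> a) [^]\<^bsub>?GD\<^esub> k | a k. a \<in> \<Gamma> \<and> power_rel a k \<in> R}"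
  let ?N = "normal_closure ?GA {commutator ?GA (artin_gen \<Gamma> R a [^]\<^bsub>?GA\<^esub> k) y | a k y.
    a \<in> \<Gamma> \<and> power_rel a k \<in> R \<and> y \<in> carrier ?GA}"
  let ?F = "free_Abelian_group (fin_gen_classes G (\<iota> ` \<Gamma>))"
  interpret H: group H by simp
  interpret GD: group ?GD by simp
  interpret F: group_hom H ?GD to_GD by unfold_locales (rule to_GD_hom)
  have inj: "inj_on to_GD (carrier H)" and surj: "to_GD ` carrier H = carrier ?GD"
    using to_GD_iso by (auto simp: iso_def bij_betw_def)
  obtain p where p: "p \<in> epi ?GA H" "\<And>a. a \<in> \<Gamma> \<Longrightarrow> p (artin_gen \<Gamma> R a) = x a"
    "kernel ?GA H p = ?N"
    by (rule artin_to_H) blast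
  have p_closed: "p y \<in> carrier H" if "y \<in> carrier ?GA" for y
    using p(1) that by (auto simp: epi_def)
  have Z: "to_GD ` H_central = ?Z"
  proof -
    have "to_GD (x a [^]\<^bsub>H\<^esub> k) = D.e (\<iota> a) [^]\<^bsub>?GD\<^esub> k" if "a \<in> \<Gamma>" for a and k :: nat
      using that by (simp add: F.hom_nat_pow to_GD_x)
    then show ?thesis unfolding H_central_def by (auto simp: image_iff) metis+
  qed
  have ker_g: "kernel ?GD G D.counit = to_GD ` kernel H G proj"
    using counit_to_GD by (auto simp: kernel_def simp flip: surj)
  have f: "to_GD \<circ> p \<in> epi ?GA ?GD"
    using p(1) surj Group.hom_compose[of p ?GA H to_GD ?GD] to_GD_hom
      image_comp[of to_GD p "carrier ?GA"]
    by (simp add: epi_def del: image_comp)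
  have g: "D.counit \<in> epi ?GD G"
    using D.counit_hom counit_to_GD proj_surj by (auto simp: epi_def image_image simp flip: surj)
  have gens: "\<forall>a\<in>\<Gamma>. (to_GD \<circ> p) (artin_gen \<Gamma> R a) = D.e (\<iota> a) \<and> D.counit (D.e (\<iota> a)) = \<iota> a"
    by (simp add: p(2) to_GD_x D.counit_e \<iota>_in_quandle)
  have ker_f: "kernel ?GA ?GD (to_GD \<circ> p) = ?N"
  proof -
    have "to_GD (p y) = \<one>\<^bsub>?GD\<^esub> \<longleftrightarrow> p y = \<one>\<^bsub>H\<^esub>" if "y \<in> carrier ?GA" for y
      using inj_on_eq_iff[OF inj p_closed[OF that] H.one_closed] F.hom_one by simp
    then show ?thesis by (auto simp: kernel_def simp flip: p(3))
  qed
  have central: "?Z \<subseteq> group_center ?GD"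
    using power_e_kernel D.kernel_counit_central by blast
  have sub: "H_central \<subseteq> carrier H" using H_central_central H.group_center_closed by blast
  have ker: "kernel ?GD G D.counit = generate ?GD ?Z"
    using F.generate_img[OF sub] by (simp add: ker_g kernel_proj Z)
  obtain i where i: "i \<in> mon ?F H" "i ` carrier ?F = generate H H_central"
    by (rule free_Abelian_kernel)
  have "central_extension ?F (to_GD \<circ> i) ?GD D.counit G"
    unfolding central_extension_def
  proof (intro conjI)
    have "i ` carrier ?F \<subseteq> carrier H"
      unfolding i(2) by (rule H.generate_incl[OF sub])
    then have "inj_on (to_GD \<circ> i) (carrier ?F)"
      using i(1) inj_on_subset[OF inj] by (intro comp_inj_on) (simp_all add: mon_def)
    moreover have "to_GD \<circ> i \<in> hom ?F ?GD"
      using i(1) by (intro Group.hom_compose[OF _ to_GD_hom]) (simp add: mon_def)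
    ultimately show "to_GD \<circ> i \<in> mon ?F ?GD" by (simp add: mon_def)
    show im: "(to_GD \<circ> i) ` carrier ?F = kernel ?GD G D.counit"
      unfolding image_comp[symmetric] i(2) ker_g kernel_proj ..
    show "(to_GD \<circ> i) ` carrier ?F \<subseteq> group_center ?GD"
      unfolding im by (rule D.kernel_counit_central)
  qed (use g \<open>group G\<close> in simp_all)
  then show ?thesis
    unfolding Let_def using f g gens ker_f central ker by blast
qed

end
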